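(* Let $G=(V,E,\mu,w)$ be a weighted forest with $n$ vertices satisfying $\mu_v=\sum_{u\in V:\{u,v\}\in E}w_{uv}$ for all $v\in V$. Then for every $p\ge1$ and every $k\in\{1,\dots,n\}$, $$\frac{2^{p-1}}{p^p}\,h_k(G)^p\ \le\ \lambda_k(\Delta_p)\ \le\ 2^{p-1}h_k(G).$$
   Context: A weighted graph is a quadruple $G=(V,E,\mu,w)$ with finite vertex set $V=\{1,\dots,n\}$, edge set $E\subseteq\{\{u,v\}:u\neq v\text{ in }V\}$, vertex weight $\mu:V\to(0,\infty)$ and edge weight $w:E\to(0,\infty)$; write $\mu_v=\mu(v)$, $w_{uv}=w(\{u,v\})$. A weighted forest is a weighted graph whose underlying graph has no cycles (it need not be connected). For nonempty $A\subseteq V$, $\partial A=\{\{u,v\}\in E:u\in A,\ v\notin A\}$ and $\phi(A)=\dfrac{\sum_{\{u,v\}\in\partial A}w_{uv}}{\sum_{v\in A}\mu_v}$. The Cheeger $k$-constant is $h_k(G)=\min\max_{1\le i\le k}\phi(A_i)$, the minimum being over all $k$-tuples $(A_1,\dots,A_k)$ of pairwise disjoint nonempty subsets of $V$. The $k$-th min-max eigenvalue of the graph $p$-Laplacian is $$\lambda_k(\Delta_p)=\inf_{S}\ \max_{x\in S}\frac{\sum_{\{u,v\}\in E}w_{uv}|x_u-x_v|^p}{\sum_{v\in V}\mu_v|x_v|^p},$$ the infimum over all nonempty compact $S\subset\mathbb R^n\setminus\{0\}$ with $S=-S$ and $\gamma(S)\ge k$, where $\gamma(S)=\min\{m\in\mathbb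 Z^+:\text{there is an odd continuous map }S\to\mathbb R^m\setminus\{0\}\}$ is the Krasnoselskii genus. *)

theory Defs
  imports "HOL-Analysis.Analysis"
begin

section \<open>Weighted graphs and forests\<close>

text \<open>The vertex set is the whole of a finite type \<open>'v\<close>, with \<open>CARD('v)\<close> in the role of \<open>n\<close>.
  Edges are two-element sets of vertices; only the values of \<open>w\<close> on \<open>E\<close> are relevant.\<close>

locale weighted_graph =
  fixes E :: "'v::finite set set" and \<mu> :: "'v \<Rightarrow> real" and w :: "'v set \<Rightarrow> real"
  assumes edges: "E \<subseteq> {{u, v} |u v. u \<noteq> v}"
    and vertex_weight_pos: "\<And>v. 0 < \<mu> v"
    and edge_weight_pos: "\<And>e. e \<in> E \<Longrightarrow> 0 < w e"

definition cycle_in :: "'v set set \<Rightarrow> 'v list \<Rightarrow> bool" where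
  "cycle_in E c \<longleftrightarrow> 3 \<le> length c \<and> distinct c \<and>
     (\<forall>i < length c. {c ! i, c ! (Suc i mod length c)} \<in> E)"

locale weighted_forest = weighted_graph +
  assumes no_cycle: "\<not> (\<exists>c. cycle_in E c)"

section \<open>Cheeger constants\<close>

definition boundary :: "'v set set \<Rightarrow> 'v set \<Rightarrow> 'v set set" where
  "boundary E A = {{u, v} |u v. {u, v} \<in> E \<and> u \<in> A \<and> v \<notin> A}"

definition expansion ::
  "'v::finite set set \<Rightarrow> ('v \<Rightarrow> real) \<Rightarrow> ('v set \<Rightarrow> real) \<Rightarrow> 'v set \<Rightarrow> real" where
  "expansion E \<mu> w A = (\<Sum>e\<in>boundary E A. w e) / (\<Sum>v\<in>A. \<mu> v)"

definition cheeger_tuple :: "nat \<Rightarrow> (nat \<Rightarrow> 'v set) \<Rightarrow> bool" where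
  "cheeger_tuple k A \<longleftrightarrow> (\<forall>i\<in>{1..k}. A i \<noteq> {}) \<and> disjoint_family_on A {1..k}"

definition cheeger_const ::
  "'v::finite set set \<Rightarrow> ('v \<Rightarrow> real) \<Rightarrow> ('v set \<Rightarrow> real) \<Rightarrow> nat \<Rightarrow> real" where
  "cheeger_const E \<mu> w k =
     Min {Max ((\<lambda>i. expansion E \<mu> w (A i)) ` {1..k}) |A. cheeger_tuple k A}"

text \<open>\<open>Min\<close> is unspecified on infinite or empty sets; this is not an issue for
  \<open>1 \<le> k \<le> CARD('v)\<close>.\<close>

lemma finite_cheeger_values:
  assumes "1 \<le> k"
  shows "finite {Max ((\<lambda>i. expansion E \<mu> w (A i)) ` {1..k}) |A. cheeger_tuple k A}"
proof (rule finite_subset)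
  show "{Max ((\<lambda>i. expansion E \<mu> w (A i)) ` {1..k}) |A. cheeger_tuple k A}
          \<subseteq> range (expansion E \<mu> w)"
  proof clarify
    fix A :: "nat \<Rightarrow> 'a set"
    have "Max ((\<lambda>i. expansion E \<mu> w (A i)) ` {1..k}) \<in> (\<lambda>i. expansion E \<mu> w (A i)) ` {1..k}"
      using assms by (intro Max_in) auto
    then show "Max ((\<lambda>i. expansion E \<mu> w (A i)) ` {1..k}) \<in> range (expansion E \<mu> w)"
      by auto
  qed
qed simp

lemma ex_cheeger_tuple:
  assumes "k \<le> CARD('v::finite)"
  shows "\<exists>A :: nat \<Rightarrow> 'v set. cheeger_tuple k A"
proof -
  obtain f where f: "f ` {1..k} \<subseteq> (UNIV :: 'v set)" "inj_on f {1..k}"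
    using card_le_inj[of "{1..k}" "UNIV :: 'v set"] assms by auto
  then have "cheeger_tuple k (\<lambda>i. {f i})"
    by (auto simp: cheeger_tuple_def disjoint_family_on_def dest: inj_onD)
  then show ?thesis by blast
qed

section \<open>Krasnoselskii genus\<close>

definition odd_map_into ::
  "'a::real_normed_vector set \<Rightarrow> nat \<Rightarrow> ('a \<Rightarrow> nat \<Rightarrow> real) \<Rightarrow> bool" where
  "odd_map_into S m f \<longleftrightarrow>
     continuous_map (top_of_set S) (subtopology (Euclidean_space m) (- {\<lambda>_. 0})) f \<and>
     (\<forall>x\<in>S. f (- x) = (\<lambda>i. - f x i))"

definition genus :: "'a::real_normed_vector set \<Rightarrow> nat" where
  "genus S = (LEAST m. 0 < m \<and> (\<exists>f. odd_map_into S m f))"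

text \<open>The set of admissible \<open>m\<close> is nonempty for the sets used below, since the
  inclusion is an odd map.\<close>

lemma ex_odd_map_into:
  fixes S :: "(real ^ 'n) set"
  assumes "0 \<notin> S"
  shows "\<exists>f. odd_map_into S CARD('n) f"
proof -
  obtain h where h: "bij_betw h {0..<CARD('n)} (UNIV :: 'n set)"
    using ex_bij_betw_nat_finite[of "UNIV :: 'n set"] by auto
  define f where "f = (\<lambda>(x :: real ^ 'n) i. if i < CARD('n) then x $ h i else 0)"
  have "f x \<noteq> (\<lambda>_. 0)" if "x \<in> S" for x
  proof
    assume 0: "f x = (\<lambda>_. 0)"
    have "x $ j = 0" for j
    proof -
      obtain i where "i < CARD('n)" "j = h i"
        using h by (metis UNIV_I atLeastLessThan_iff bij_betw_imp_surj_on imageE)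
      then show ?thesis using fun_cong[OF 0, of i] by (simp add: f_def)
    qed
    then have "x = 0" by (simp add: vec_eq_iff)
    with that assms show False by blast
  qed
  moreover have "continuous_map (top_of_set S) (powertop_real UNIV) f"
    unfolding continuous_map_componentwise_UNIV
  proof
    fix i
    show "continuous_map (top_of_set S) euclideanreal (\<lambda>x. f x i)"
      by (cases "i < CARD('n)") (auto simp: f_def intro!: continuous_intros)
  qed
  ultimately have "continuous_map (top_of_set S)
      (subtopology (Euclidean_space CARD('n)) (- {\<lambda>_. 0})) f"
    by (auto simp: Euclidean_space_def continuous_map_in_subtopology f_def)
  moreover have "\<forall>x\<in>S. f (- x) = (\<lambda>i. - f x i)"
    by (auto simp: f_def)
  ultimately show ?thesis unfolding odd_map_into_def by blast
qed

section \<open>Min-max eigenvalues of the graph p-Laplacian\<close>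

text \<open>The sum over edges in the numerator is half the sum over ordered pairs of adjacent vertices;
  each edge \<open>{u, v}\<close> arises from exactly two such pairs because there are no loops.\<close>

definition rayleigh ::
  "'v::finite set set \<Rightarrow> ('v \<Rightarrow> real) \<Rightarrow> ('v set \<Rightarrow> real) \<Rightarrow> real \<Rightarrow> real ^ 'v \<Rightarrow> real" where
  "rayleigh E \<mu> w p x =
     ((\<Sum>(u, v) | {u, v} \<in> E. w {u, v} * \<bar>x $ u - x $ v\<bar> powr p) / 2) /
     (\<Sum>v\<in>UNIV. \<mu> v * \<bar>x $ v\<bar> powr p)"

definition genus_class :: "nat \<Rightarrow> (real ^ 'v::finite) set set" where
  "genus_class k =
     {S. S \<noteq> {} \<and> compact S \<and> 0 \<notin> S \<and> uminus ` S = S \<and> k \<le> genus S}"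

definition minmax_eigenvalue ::
  "'v::finite set set \<Rightarrow> ('v \<Rightarrow> real) \<Rightarrow> ('v set \<Rightarrow> real) \<Rightarrow> real \<Rightarrow> nat \<Rightarrow> real" where
  "minmax_eigenvalue E \<mu> w p k = (INF S\<in>genus_class k. SUP x\<in>S. rayleigh E \<mu> w p x)"

text \<open>The inner supremum is a maximum.\<close>

lemma (in weighted_graph) rayleigh_attains_sup:
  assumes "compact S" "S \<noteq> {}" "0 \<notin> S" "1 \<le> p"
  shows "\<exists>x\<in>S. rayleigh E \<mu> w p x = (SUP x\<in>S. rayleigh E \<mu> w p x) \<and>
           (\<forall>y\<in>S. rayleigh E \<mu> w p y \<le> rayleigh E \<mu> w p x)"
proof -
  have den: "(\<Sum>v\<in>UNIV. \<mu> v * \<bar>x $ v\<bar> powr p) \<noteq> 0" if "x \<in> S" for x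
  proof -
    have "x \<noteq> 0" using that assms by auto
    then obtain j where "x $ j \<noteq> 0" by (auto simp: vec_eq_iff)
    then have "0 < (\<Sum>v\<in>UNIV. \<mu> v * \<bar>x $ v\<bar> powr p)"
      using vertex_weight_pos by (intro sum_pos2[of _ j]) (auto simp: less_imp_le)
    then show ?thesis by simp
  qed
  have "continuous_on S (rayleigh E \<mu> w p)"
    unfolding rayleigh_def case_prod_beta using assms den
    by (intro continuous_intros ballI continuous_on_powr') auto
  then obtain x where x: "x \<in> S" "\<forall>y\<in>S. rayleigh E \<mu> w p y \<le> rayleigh E \<mu> w p x"
    using continuous_attains_sup[OF assms(1,2)] by blast
  then have "(SUP x\<in>S. rayleigh E \<mu> w p x) = rayleigh E \<mu> w p x"
    by (intro cSup_eq_maximum) auto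
  with x show ?thesis by auto
qed

end

theory Submission
  imports Defs "HOL-Homology.Invariance_of_Domain"
begin

text \<open>
  Write \<open>\<phi>\<close> for the expansion and \<open>h\<close> for the Cheeger constant of index \<open>k\<close>.

  \<^emph>\<open>Upper bound.\<close> For an optimal tuple of disjoint sets, the combinations of their indicator functions
  with coefficient vector in the unit sphere form a compact symmetric set. It has genus at least \<open>k\<close>,
  because an odd map from it to a lower-dimensional punctured Euclidean space would violate the
  Borsuk--Ulam theorem (\<open>genus_class_disjoint_combinations\<close>). On this set the Rayleigh quotient is at
  most \<open>2 powr (p - 1) * h\<close> by convexity of the \<open>p\<close>-th power (\<open>rayleigh_disjoint_combination_le\<close>).

  \<^emph>\<open>Lower bound.\<close> The connected vertex sets with \<open>\<phi> < h\<close> contain no \<open>k\<close> pairwise disjoint members, by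
  definition of \<open>h\<close>. In a forest, connected sets have the packing-covering property: the largest
  number of disjoint members of a family equals the least number of vertices meeting all members
  (\<open>forest_packing_covering\<close>). So some set \<open>T\<close> of fewer than \<open>k\<close> vertices meets every vertex set with
  \<open>\<phi> < h\<close> (\<open>small_hitting_set\<close>). A symmetric set of genus at least \<open>k\<close> contains a vector \<open>x\<close> that
  vanishes on \<open>T\<close>, since otherwise restriction to \<open>T\<close> would be an odd map into fewer than \<open>k\<close>
  dimensions (\<open>genus_class_vanishing\<close>). Every nonempty subset of the support of \<open>x\<close> then has
  \<open>\<phi> \<ge> h\<close>, and a Cheeger-type estimate with the sharp constant bounds the Rayleigh quotient of \<open>x\<close>
  from below (\<open>rayleigh_ge_if_isoperimetric_on_support\<close>): the co-area inequality is applied to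
  \<open>\<bar>x\<bar> powr p\<close>, and differences of \<open>p\<close>-th powers are compared with \<open>p\<close>-th powers of differences.

  The Borsuk--Ulam theorem is derived from the fact that odd self-maps of spheres have odd degree.
  That is proved by induction on the dimension: an odd map is deformed through odd nonvanishing maps
  until it preserves the equator, where Borsuk's degree step \<open>Borsuk_odd_mapping_degree_step\<close> applies.
\<close>

section \<open>Odd self-maps of spheres have odd degree\<close>

lemma nsphere_eq_top_of_set: "nsphere n = top_of_set (topspace (nsphere n))"
  unfolding nsphere by (simp add: euclidean_product_topology)

lemma topspace_nsphere: "x \<in> topspace (nsphere n) \<longleftrightarrow> (\<Sum>i\<le>n. (x i)\<^sup>2) = 1 \<and> (\<forall>i>n. x i = 0)"
  by (simp add: nsphere)

definition sphere_proj :: "nat \<Rightarrow> (nat \<Rightarrow> real) \<Rightarrow> nat \<Rightarrow> real" where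
  "sphere_proj n v = (\<lambda>i. if i \<le> n then v i / sqrt (\<Sum>j\<le>n. (v j)\<^sup>2) else 0)"

lemma sum_squares_pos_iff:
  fixes v :: "nat \<Rightarrow> real"
  shows "0 < (\<Sum>j\<le>n. (v j)\<^sup>2) \<longleftrightarrow> (\<exists>j\<le>n. v j \<noteq> 0)"
proof -
  have "(\<Sum>j\<le>n. (v j)\<^sup>2) = 0 \<longleftrightarrow> (\<forall>j\<in>{..n}. (v j)\<^sup>2 = 0)"
    by (rule sum_nonneg_eq_0_iff) auto
  moreover have "0 \<le> (\<Sum>j\<le>n. (v j)\<^sup>2)" by (simp add: sum_nonneg)
  ultimately show ?thesis by (auto simp: less_le)
qed

lemma sphere_proj_in_nsphere:
  assumes "\<exists>j\<le>n. v j \<noteq> 0"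
  shows "sphere_proj n v \<in> topspace (nsphere n)"
proof -
  let ?s = "\<Sum>j\<le>n. (v j)\<^sup>2"
  have s: "0 < ?s" using assms by (simp add: sum_squares_pos_iff)
  have "(\<Sum>i\<le>n. (sphere_proj n v i)\<^sup>2) = (\<Sum>i\<le>n. (v i)\<^sup>2 / ?s)"
    using s by (intro sum.cong) (auto simp: sphere_proj_def power_divide)
  also have "\<dots> = 1" using s by (simp flip: sum_divide_distrib)
  finally show ?thesis by (simp add: topspace_nsphere) (simp add: sphere_proj_def)
qed

lemma sphere_proj_nsphere: "x \<in> topspace (nsphere n) \<Longrightarrow> sphere_proj n x = x"
  by (auto simp: sphere_proj_def topspace_nsphere fun_eq_iff)

lemma sphere_proj_uminus: "sphere_proj n (\<lambda>i. - v i) = (\<lambda>i. - sphere_proj n v i)"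
  by (auto simp: sphere_proj_def)

lemma continuous_on_sphere_proj:
  assumes "\<And>i. i \<le> n \<Longrightarrow> continuous_on X (\<lambda>x. F x i)" and "\<And>x. x \<in> X \<Longrightarrow> \<exists>j\<le>n. F x j \<noteq> 0"
  shows "continuous_on X (\<lambda>x. sphere_proj n (F x))"
proof (rule continuous_on_coordinatewise_then_product)
  fix i
  have "(\<Sum>j\<le>n. (F x j)\<^sup>2) \<noteq> 0" if "x \<in> X" for x
    using assms(2)[OF that] sum_squares_pos_iff[where v = "F x" and n = n] by auto
  then show "continuous_on X (\<lambda>x. sphere_proj n (F x) i)"
    using assms(1) by (cases "i \<le> n") (auto simp: sphere_proj_def intro!: continuous_intros)
qed

lemma homotopic_sphere_proj_segment:
  assumes f: "\<And>i. i \<le> n \<Longrightarrow> continuous_on (topspace (nsphere n)) (\<lambda>x. f x i)"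
    and g: "\<And>i. i \<le> n \<Longrightarrow> continuous_on (topspace (nsphere n)) (\<lambda>x. g x i)"
    and nz: "\<And>x t. \<lbrakk>x \<in> topspace (nsphere n); 0 \<le> t; t \<le> 1\<rbrakk> \<Longrightarrow> \<exists>i\<le>n. (1 - t) * f x i + t * g x i \<noteq> 0"
  shows "homotopic_with (\<lambda>_. True) (nsphere n) (nsphere n)
           (\<lambda>x. sphere_proj n (f x)) (\<lambda>x. sphere_proj n (g x))"
proof -
  let ?S = "topspace (nsphere n)"
  let ?F = "\<lambda>(t, x) i. (1 - t) * f x i + t * g x i"
  let ?h = "\<lambda>z. sphere_proj n (?F z)"
  have "continuous_on ({0..1} \<times> ?S) ?h"
  proof (rule continuous_on_sphere_proj)
    show "continuous_on ({0..1} \<times> ?S) (\<lambda>z. ?F z i)" if "i \<le> n" for i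
      unfolding case_prod_beta
      by (intro continuous_intros continuous_on_compose2[OF f[OF that]]
          continuous_on_compose2[OF g[OF that]]) auto
    show "\<exists>j\<le>n. ?F z j \<noteq> 0" if "z \<in> {0..1} \<times> ?S" for z
      using that nz by auto
  qed
  moreover have "?h z \<in> ?S" if "z \<in> {0..1} \<times> ?S" for z
    using that nz by (intro sphere_proj_in_nsphere) auto
  ultimately have "continuous_map (prod_topology (top_of_set {0..1}) (top_of_set ?S)) (top_of_set ?S) ?h"
    by (auto simp flip: subtopology_Times simp: continuous_map_in_subtopology image_subset_iff)
  then have cont: "continuous_map (prod_topology (top_of_set {0..1}) (nsphere n)) (nsphere n) ?h"
    by (simp only: nsphere_eq_top_of_set[symmetric])
  show ?thesis
    unfolding homotopic_with_def
    by (rule exI[of _ ?h]) (use cont in \<open>simp add: split_def\<close>)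
qed

text \<open>The odd part of a polynomial approximation of an odd map is at least as good an approximation.\<close>

lemma odd_polynomial_approximation:
  fixes F :: "'a::euclidean_space \<Rightarrow> 'a"
  assumes "compact K" "continuous_on K F" "0 < e" "subspace T" "F ` K \<subseteq> T"
    and sym: "\<And>x. x \<in> K \<Longrightarrow> - x \<in> K" and odd: "\<And>x. x \<in> K \<Longrightarrow> F (- x) = - F x"
  obtains q where "polynomial_function q" "\<And>x. q (- x) = - q x" "q ` K \<subseteq> T"
    "\<And>x. x \<in> K \<Longrightarrow> norm (F x - q x) < e"
proof -
  obtain g where g: "polynomial_function g" "g ` K \<subseteq> T" "\<And>x. x \<in> K \<Longrightarrow> norm (F x - g x) < e"
    using Stone_Weierstrass_polynomial_function_subspace[OF assms(1-5)] by metis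
  define q where "q x = (1/2) *\<^sub>R (g x - g (- x))" for x
  show ?thesis
  proof
    have "polynomial_function (\<lambda>x::'a. - x)"
      using polynomial_function_minus[OF polynomial_function_id] by (simp add: id_def)
    from polynomial_function_compose[OF this g(1)] show "polynomial_function q"
      unfolding q_def o_def using g(1) by (intro polynomial_function_cmul polynomial_function_diff)
    show "q (- x) = - q x" for x by (simp add: q_def algebra_simps)
    show "q ` K \<subseteq> T"
      using g(2) sym assms(4) by (auto simp: q_def image_subset_iff intro!: subspace_scale subspace_diff)
    fix x assume x: "x \<in> K"
    have "F x - q x = (1/2) *\<^sub>R ((F x - g x) - (F (- x) - g (- x)))"
      using odd[OF x] by (simp add: q_def algebra_simps flip: scaleR_left.add)
    also have "norm \<dots> \<le> (1/2) * (norm (F x - g x) + norm (F (- x) - g (- x)))"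
      by (simp add: norm_triangle_ineq4)
    also have "\<dots> < e" using g(3)[OF x] g(3)[OF sym[OF x]] by simp
    finally show "norm (F x - q x) < e" .
  qed
qed

text \<open>General position. The unit sphere of the span of \<open>B\<close> has dimension \<open>card B - 1\<close>, so the cone over its
  image under a smooth map has dimension at most \<open>card B\<close> and cannot fill the span of \<open>insert e B\<close>.
  To phrase this with Lebesgue measure on the whole space, the image is thickened by the directions
  outside \<open>insert e B\<close>: the result is a differentiable image of a part of the hyperplane orthogonal
  to \<open>e\<close>, hence negligible.\<close>

lemma line_avoiding_low_dimensional_sphere_image:
  fixes q :: "'a::euclidean_space \<Rightarrow> 'a"
  assumes B: "B \<subseteq> Basis" "e \<in> Basis" "e \<notin> B"
    and q: "q differentiable_on UNIV" "\<And>x. q (- x) = - q x"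
  obtains y where "y \<bullet> e \<noteq> 0"
    "\<And>x s. \<lbrakk>norm x = 1; \<And>i. i \<in> Basis - B \<Longrightarrow> x \<bullet> i = 0; s \<noteq> 0;
       \<And>i. i \<in> Basis - insert e B \<Longrightarrow> q x \<bullet> i = 0\<rbrakk> \<Longrightarrow> \<exists>i\<in>insert e B. q x \<bullet> i \<noteq> s * (y \<bullet> i)"
proof -
  define p where "p z = (\<Sum>i\<in>B. (z \<bullet> i) *\<^sub>R i)" for z :: 'a
  \<comment> \<open>Homogeneous of degree one in the directions of \<open>B\<close>, the identity in the other directions.\<close>
  define \<Psi> where "\<Psi> z = norm (p z) *\<^sub>R q (inverse (norm (p z)) *\<^sub>R p z) + (z - p z)" for z
  define D where "D = {z. e \<bullet> z = 0} \<inter> {z. p z \<noteq> 0}"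
  have linp: "linear p" unfolding p_def
    by (intro linear_compose_sum ballI) (auto intro!: linearI simp: inner_add_left algebra_simps)
  then have dp: "p differentiable_on X" for X
    by (simp add: linear_imp_differentiable_on)
  have finB: "finite B" using finite_subset[OF B(1) finite_Basis] .
  have hyp: "negligible {z. e \<bullet> z = 0}"
    using B nonzero_Basis by (intro negligible_hyperplane) auto
  have "negligible (\<Psi> ` D)"
  proof (rule negligible_differentiable_image_negligible)
    show "negligible D" unfolding D_def using hyp by (rule negligible_subset) auto
    have dnp: "(\<lambda>z. norm (p z)) differentiable_on D"
      by (rule differentiable_on_compose[where f = norm and g = p, OF dp])
        (auto simp: D_def differentiable_on_def intro!: differentiable_at_withinI differentiable_norm_at)
    have "(\<lambda>z. q (inverse (norm (p z)) *\<^sub>R p z)) differentiable_on D"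
      by (rule differentiable_on_compose[where f = q])
        (auto simp: D_def intro!: derivative_intros dp dnp[unfolded D_def] differentiable_on_subset[OF q(1)])
    then show "\<Psi> differentiable_on D"
      unfolding \<Psi>_def by (intro derivative_intros dp dnp)
  qed simp
  then have "negligible (\<Psi> ` D \<union> {z. e \<bullet> z = 0})"
    using hyp by (simp add: negligible_Un)
  then have "\<Psi> ` D \<union> {z. e \<bullet> z = 0} \<noteq> UNIV"
    by (metis non_negligible_UNIV)
  then obtain y where y: "y \<notin> \<Psi> ` D" "e \<bullet> y \<noteq> 0"
    by auto
  have pos: False if x: "norm x = 1" "\<And>i. i \<in> Basis - B \<Longrightarrow> x \<bullet> i = 0" and s: "s > 0"
     and T: "\<And>i. i \<in> Basis - insert e B \<Longrightarrow> q x \<bullet> i = 0"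
     and eq: "\<And>i. i \<in> insert e B \<Longrightarrow> q x \<bullet> i = s * (y \<bullet> i)" for x s
  proof -
    \<comment> \<open>The point \<open>z\<close> is a preimage of \<open>y\<close> under \<open>\<Psi>\<close>, assembled from \<open>x\<close> and the outer part \<open>r\<close> of \<open>y\<close>.\<close>
    define r where "r = (\<Sum>i\<in>Basis - insert e B. (y \<bullet> i) *\<^sub>R i)"
    define z where "z = inverse s *\<^sub>R x + r"
    have ri: "r \<bullet> i = (if i \<in> insert e B then 0 else y \<bullet> i)" if "i \<in> Basis" for i
      unfolding r_def using that by (simp add: inner_sum_left inner_Basis if_distrib cong: if_cong)
    have pz: "p z = inverse s *\<^sub>R x"
    proof (rule euclidean_eqI)
      fix i :: 'a assume i: "i \<in> Basis"
      have "p z \<bullet> i = (if i \<in> B then z \<bullet> i else 0)"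
        unfolding p_def using i B(1) finB
        by (subst inner_sum_left, subst sum.cong[where h = "\<lambda>j. if j = i then z \<bullet> i else 0"])
          (auto simp: inner_Basis subset_iff)
      then show "p z \<bullet> i = (inverse s *\<^sub>R x) \<bullet> i"
        using ri[OF i] x(2)[of i] i by (auto simp: z_def inner_add_left)
    qed
    have np: "norm (p z) = inverse s" using s x by (simp add: pz)
    have "z - p z = r" unfolding pz by (simp add: z_def)
    then have \<Psi>z: "\<Psi> z = inverse s *\<^sub>R q x + r"
      unfolding \<Psi>_def np using s by (simp add: pz)
    have "z \<in> D"
    proof -
      have "x \<noteq> 0" using x(1) by auto
      then have "p z \<noteq> 0" using s by (simp add: pz)
      moreover have "e \<bullet> z = 0"
        using x(2)[of e] B ri[of e] by (simp add: z_def inner_add_right inner_commute)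
      ultimately show ?thesis by (simp add: D_def)
    qed
    moreover have "\<Psi> z = y"
    proof (rule euclidean_eqI)
      fix i :: 'a assume i: "i \<in> Basis"
      show "\<Psi> z \<bullet> i = y \<bullet> i"
        using eq[of i] T[of i] ri[OF i] i s unfolding \<Psi>z
          by (cases "i \<in> insert e B") (auto simp: inner_add_left field_simps)
    qed
    ultimately show False using y by auto
  qed
  show ?thesis
  proof
    show "y \<bullet> e \<noteq> 0" using y by (simp add: inner_commute)
    fix x :: 'a and s :: real
    assume x: "norm x = 1" "\<And>i. i \<in> Basis - B \<Longrightarrow> x \<bullet> i = 0" and s: "s \<noteq> 0"
      and T: "\<And>i. i \<in> Basis - insert e B \<Longrightarrow> q x \<bullet> i = 0"
    show "\<exists>i\<in>insert e B. q x \<bullet> i \<noteq> s * (y \<bullet> i)"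
    proof (rule ccontr)
      assume "\<not> ?thesis"
      then have eq: "\<And>i. i \<in> insert e B \<Longrightarrow> q x \<bullet> i = s * (y \<bullet> i)" by auto
      show False
      proof (cases "s > 0")
        case True then show False using pos[of x s] x T eq by auto
      next
        case False then show False
          using pos[of "- x" "- s"] x T eq s q(2)[of x] by auto
      qed
    qed
  qed
qed

text \<open>The zero-sphere has two points, so an odd self-map is the identity or the reflection.\<close>

lemma odd_Brouwer_degree2_0:
  assumes f: "continuous_map (nsphere 0) (nsphere 0) f"
    and odd: "\<And>x. x \<in> topspace (nsphere 0) \<Longrightarrow> f (\<lambda>i. - x i) = (\<lambda>i. - f x i)"
  shows "odd (Brouwer_degree2 0 f)"
proof -
  define a :: "nat \<Rightarrow> real" where "a = (\<lambda>i. if i = 0 then 1 else 0)"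
  have iff: "x \<in> topspace (nsphere 0) \<longleftrightarrow> x = a \<or> x = (\<lambda>i. - a i)" for x
    by (auto simp: topspace_nsphere a_def fun_eq_iff power2_eq_1_iff)
  have "f a \<in> topspace (nsphere 0)"
    using f iff by (auto dest: continuous_map_image_subset_topspace)
  then consider "f a = a" | "f a = (\<lambda>i. - a i)" using iff by blast
  then show ?thesis
  proof cases
    case 1
    then have "f x = id x" if "x \<in> topspace (nsphere 0)" for x
      using that iff odd[of a] by auto
    then have "Brouwer_degree2 0 f = Brouwer_degree2 0 id" by (rule Brouwer_degree2_eq)
    then show ?thesis by simp
  next
    case 2
    have "f x = (\<lambda>i. if i = 0 then - x i else x i)" if x: "x \<in> topspace (nsphere 0)" for x
    proof -
      have "f x = (\<lambda>i. - x i)"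
        using x iff odd[of a] 2 by auto
      moreover have "x i = 0" if "i \<noteq> 0" for i
        using x that by (simp add: topspace_nsphere)
      ultimately show ?thesis by (auto simp: fun_eq_iff)
    qed
    then have "Brouwer_degree2 0 f = Brouwer_degree2 0 (\<lambda>x i. if i = 0 then - x i else x i)"
      by (rule Brouwer_degree2_eq)
    then show ?thesis by (simp add: Brouwer_degree2_reflection)
  qed
qed

text \<open>The type \<open>'a\<close> only supplies a Euclidean space of dimension greater than \<open>n\<close>, in which approximation
  and measure theory are carried out; \<open>enc\<close> and \<open>dec\<close> identify \<open>nsphere n\<close> with the unit sphere of a
  coordinate subspace. Let \<open>Q\<close> be an odd polynomial map uniformly close to \<open>f\<close>. General position gives
  a line through \<open>y\<close>, transversal to the equatorial hyperplane, that the image of the equator under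
  \<open>Q\<close> avoids. Projecting along that line therefore keeps the image of the equator away from zero, and
  multiplying the last coordinate by the square of the last variable moves that image into the
  hyperplane; zeros could only arise on the equator, where they are excluded.\<close>

lemma odd_map_homotopic_to_equator_preserving:
  fixes a :: "'a::euclidean_space itself"
  assumes n: "n < DIM('a)"
    and f: "continuous_map (nsphere n) (nsphere n) f"
    and odd: "\<And>x. x \<in> topspace (nsphere n) \<Longrightarrow> f (\<lambda>i. - x i) = (\<lambda>i. - f x i)"
  obtains g where "homotopic_with (\<lambda>_. True) (nsphere n) (nsphere n) f g"
    "\<And>x. x \<in> topspace (nsphere n) \<Longrightarrow> g (\<lambda>i. - x i) = (\<lambda>i. - g x i)"
    "\<And>x. \<lbrakk>x \<in> topspace (nsphere n); x n = 0\<rbrakk> \<Longrightarrow> g x n = 0"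
proof -
  let ?S = "topspace (nsphere n)"
  obtain b where b: "bij_betw b {..<DIM('a)} (Basis :: 'a set)"
    using ex_bij_betw_nat_finite[OF finite_Basis] by (auto simp: atLeast0LessThan)
  have bB: "b i \<in> Basis" if "i \<le> n" for i
    using that n b by (auto simp: bij_betw_def)
  have binj: "b i = b j \<longleftrightarrow> i = j" if "i \<le> n" "j \<le> n" for i j
    using that n b by (auto simp: bij_betw_def inj_on_def)
  define enc where "enc x = (\<Sum>i\<le>n. x i *\<^sub>R b i)" for x :: "nat \<Rightarrow> real"
  define dec where "dec y = (\<lambda>i. if i \<le> n then y \<bullet> b i else 0)" for y
  define T where "T = {y. \<forall>i\<in>Basis - b ` {..n}. y \<bullet> i = 0}"
  define K where "K = sphere 0 1 \<inter> T"
  have T: "subspace T" by (auto simp: T_def subspace_def inner_add_left)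
  have enc_b: "enc x \<bullet> b i = x i" if "i \<le> n" for x i
  proof -
    have "enc x \<bullet> b i = (\<Sum>j\<le>n. if j = i then x i else 0)"
      unfolding enc_def inner_sum_left using that bB binj
      by (intro sum.cong) (auto simp: inner_Basis)
    then show ?thesis using that by simp
  qed
  have enc_T: "enc x \<in> T" for x
    using bB by (auto simp: T_def enc_def inner_sum_left inner_Basis intro!: sum.neutral)
  have eqT: "y = z" if "y \<in> T" "z \<in> T" "\<And>i. i \<le> n \<Longrightarrow> y \<bullet> b i = z \<bullet> b i" for y z
  proof (rule euclidean_eqI)
    fix i :: 'a assume "i \<in> Basis"
    then show "y \<bullet> i = z \<bullet> i"
      using that by (cases "i \<in> b ` {..n}") (auto simp: T_def)
  qed
  have dec_enc: "dec (enc x) = x" if "x \<in> ?S" for x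
    using that by (auto simp: dec_def enc_b topspace_nsphere)
  have enc_dec: "enc (dec y) = y" if "y \<in> T" for y
    by (rule eqT[OF enc_T that]) (simp add: enc_b, simp add: dec_def)
  have norm_enc: "(norm (enc x))\<^sup>2 = (\<Sum>i\<le>n. (x i)\<^sup>2)" for x
  proof -
    have "enc x \<bullet> enc x = (\<Sum>i\<le>n. x i * (enc x \<bullet> b i))"
      by (subst (2) enc_def) (simp add: inner_sum_right)
    also have "\<dots> = (\<Sum>i\<le>n. (x i)\<^sup>2)"
      by (intro sum.cong) (auto simp: enc_b power2_eq_square)
    finally show ?thesis by (simp add: power2_norm_eq_inner)
  qed
  have enc_K: "enc x \<in> K" if "x \<in> ?S" for x
  proof -
    have "(norm (enc x))\<^sup>2 = 1" using that by (simp add: norm_enc topspace_nsphere)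
    then show ?thesis using enc_T[of x] by (simp add: K_def power2_eq_1_iff) (smt (verit) norm_ge_zero)
  qed
  have dec_S: "dec y \<in> ?S" if "y \<in> K" for y
  proof -
    have "(\<Sum>i\<le>n. (dec y i)\<^sup>2) = (norm y)\<^sup>2"
      using that enc_dec[of y] norm_enc[of "dec y"] by (simp add: K_def)
    then show ?thesis using that by (simp add: topspace_nsphere K_def) (simp add: dec_def)
  qed
  have f': "continuous_map (top_of_set ?S) (top_of_set ?S) f"
    using f by (simp only: nsphere_eq_top_of_set[symmetric])
  then have cf: "continuous_on ?S f" by (simp add: continuous_map_in_subtopology)
  have fS: "f x \<in> ?S" if "x \<in> ?S" for x
    using f' that by (auto simp: continuous_map_in_subtopology)
  have cfi: "continuous_on ?S (\<lambda>x. f x i)" for i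
    using cf by (rule continuous_on_product_then_coordinatewise)
  have cenc: "continuous_on X enc" for X
    unfolding enc_def
    by (intro continuous_intros continuous_on_product_then_coordinatewise continuous_on_id)
  have cdec: "continuous_on X dec" for X
    unfolding dec_def
  proof (rule continuous_on_coordinatewise_then_product)
    show "continuous_on X (\<lambda>y. if i \<le> n then y \<bullet> b i else 0)" for i
      by (cases "i \<le> n") (auto intro!: continuous_intros)
  qed
  have enc_neg: "enc (\<lambda>i. - x i) = - enc x" for x
    by (simp add: enc_def sum_negf)
  have dec_neg: "dec (- y) = (\<lambda>i. - dec y i)" for y
    by (auto simp: dec_def)
  define F where "F = enc \<circ> f \<circ> dec"
  have "compact K" unfolding K_def by (intro compact_Int_closed closed_subspace T) simp
  moreover have "continuous_on K F"
    unfolding F_def o_def using dec_S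
    by (intro continuous_on_compose2[OF cenc] continuous_on_compose2[OF cf cdec]) auto
  moreover have "F (- y) = - F y" if "y \<in> K" for y
    using odd[OF dec_S[OF that]] by (simp add: F_def dec_neg enc_neg)
  moreover have "- y \<in> K" if "y \<in> K" for y
    using that by (auto simp: K_def T_def)
  ultimately obtain q where q: "polynomial_function q" "\<And>y. q (- y) = - q y" "q ` K \<subseteq> T"
    "\<And>y. y \<in> K \<Longrightarrow> norm (F y - q y) < 1"
    using odd_polynomial_approximation[of K F 1 T] T enc_T by (auto simp: F_def image_subset_iff)
  define Q where "Q x i = q (enc x) \<bullet> b i" for x i
  have Q_neg: "Q (\<lambda>i. - x i) j = - Q x j" for x j
    by (simp add: Q_def enc_neg q(2))
  have cQ: "continuous_on X (\<lambda>x. Q x i)" for X i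
    unfolding Q_def
    by (intro continuous_intros continuous_on_compose2[OF continuous_on_polymonial_function[OF q(1)] cenc])
      auto
  \<comment> \<open>The segment from \<open>f x\<close> to \<open>Q x\<close> avoids the origin: \<open>f x\<close> is a unit vector and \<open>Q x\<close> is at distance less than one.\<close>
  have seg1: "\<exists>i\<le>n. (1 - t) * f x i + t * Q x i \<noteq> 0" if x: "x \<in> ?S" and t: "0 \<le> t" "t \<le> 1" for x t
  proof (rule ccontr)
    assume "\<not> ?thesis"
    then have 0: "(1 - t) * f x i + t * Q x i = 0" if "i \<le> n" for i using that by auto
    let ?y = "enc x"
    have y: "?y \<in> K" using enc_K x .
    have "(1 - t) *\<^sub>R F ?y + t *\<^sub>R q ?y = 0"
    proof (rule eqT)
      show "(1 - t) *\<^sub>R F ?y + t *\<^sub>R q ?y \<in> T"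
        using enc_T q(3) y by (intro subspace_add subspace_scale T) (auto simp: F_def)
      show "0 \<in> T" using T by (rule subspace_0)
      show "((1 - t) *\<^sub>R F ?y + t *\<^sub>R q ?y) \<bullet> b i = 0 \<bullet> b i" if "i \<le> n" for i
        using 0[OF that] that by (simp add: inner_add_left F_def dec_enc x enc_b Q_def)
    qed
    then have "F ?y = t *\<^sub>R (F ?y - q ?y)" by (simp add: algebra_simps)
    then have "norm (F ?y) = t * norm (F ?y - q ?y)"
      by (metis abs_of_nonneg norm_scaleR t(1))
    also have "\<dots> \<le> norm (F ?y - q ?y)" using t by (simp add: mult_left_le_one_le)
    also have "\<dots> < 1" using q(4) y .
    finally have "norm (F ?y) < 1" .
    moreover have "F ?y \<in> K" unfolding F_def by (simp add: dec_enc x enc_K fS)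
    ultimately show False by (simp add: K_def)
  qed
  have Q_nz: "\<exists>i\<le>n. Q x i \<noteq> 0" if "x \<in> ?S" for x
    using seg1[OF that, of 1] by simp
  define B where "B = b ` {..<n}"
  have insB: "insert (b n) B = b ` {..n}"
    by (auto simp: B_def le_less)
  obtain y where y: "y \<bullet> b n \<noteq> 0" and y_line:
    "\<And>x s. \<lbrakk>norm x = 1; \<And>i. i \<in> Basis - B \<Longrightarrow> x \<bullet> i = 0; s \<noteq> 0;
       \<And>i. i \<in> Basis - insert (b n) B \<Longrightarrow> q x \<bullet> i = 0\<rbrakk> \<Longrightarrow> \<exists>i\<in>insert (b n) B. q x \<bullet> i \<noteq> s * (y \<bullet> i)"
  proof (rule line_avoiding_low_dimensional_sphere_image[of B "b n" q])
    show "B \<subseteq> Basis" "b n \<in> Basis" "b n \<notin> B"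
      using bB binj by (auto simp: B_def)
    show "q differentiable_on UNIV" using q(1) by (rule differentiable_on_polynomial_function)
    show "q (- x) = - q x" for x by (rule q(2))
  qed blast
  have Q_line: "\<exists>i\<le>n. Q x i \<noteq> s * (y \<bullet> b i)" if x: "x \<in> ?S" "x n = 0" and s: "s \<noteq> 0" for x s
  proof -
    have xK: "enc x \<in> K" using enc_K x by blast
    have "\<exists>i\<in>insert (b n) B. q (enc x) \<bullet> i \<noteq> s * (y \<bullet> i)"
    proof (rule y_line)
      show "norm (enc x) = 1" using xK by (simp add: K_def)
      show "enc x \<bullet> i = 0" if "i \<in> Basis - B" for i
        using that xK x(2) enc_b[of n x] insB by (cases "i = b n") (auto simp: K_def T_def)
      show "q (enc x) \<bullet> i = 0" if "i \<in> Basis - insert (b n) B" for i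
        using that xK q(3) insB by (auto simp: T_def)
    qed (rule s)
    then show ?thesis unfolding insB by (auto simp: Q_def)
  qed
  define P where "P x i = (if i < n then Q x i - Q x n * (y \<bullet> b i) / (y \<bullet> b n) else (x n)\<^sup>2 * Q x n)" for x i
  \<comment> \<open>At a zero on the segment from \<open>Q\<close> to \<open>P\<close>, the last coordinate forces \<open>t = 1\<close> and \<open>x n = 0\<close>; then \<open>Q x\<close> lies on the line through \<open>y\<close>.\<close>
  have seg2: "\<exists>i\<le>n. (1 - t) * Q x i + t * P x i \<noteq> 0" if x: "x \<in> ?S" and t: "0 \<le> t" "t \<le> 1" for x t
  proof (rule ccontr)
    assume "\<not> ?thesis"
    then have 0: "(1 - t) * Q x i + t * P x i = 0" if "i \<le> n" for i using that by auto
    have lt: "Q x i = t * (Q x n * (y \<bullet> b i) / (y \<bullet> b n))" if "i < n" for i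
      using 0[of i] that by (simp add: P_def algebra_simps)
    have "Q x n \<noteq> 0"
      using Q_nz[OF x] lt by (metis le_neq_implies_less mult_zero_left mult_zero_right div_0)
    moreover have "Q x n * ((1 - t) + t * (x n)\<^sup>2) = 0"
      using 0[of n] by (simp add: P_def algebra_simps)
    ultimately have *: "(1 - t) + t * (x n)\<^sup>2 = 0" by simp
    have "0 \<le> t * (x n)\<^sup>2" using t by simp
    with * t have "t = 1" by linarith
    with * have "x n = 0" by simp
    obtain i where "i \<le> n" "Q x i \<noteq> (Q x n / (y \<bullet> b n)) * (y \<bullet> b i)"
      using Q_line[OF x \<open>x n = 0\<close>, of "Q x n / (y \<bullet> b n)"] \<open>Q x n \<noteq> 0\<close> y by auto
    then show False using lt[of i] \<open>t = 1\<close> y by (cases "i = n") auto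
  qed
  have cx: "continuous_on X (\<lambda>x. x i)" for X :: "(nat \<Rightarrow> real) set" and i
    by (rule continuous_on_product_then_coordinatewise[OF continuous_on_id])
  have cP: "continuous_on ?S (\<lambda>x. P x i)" for i
    unfolding P_def using y by (cases "i < n") (auto intro!: continuous_intros cQ cx)
  show ?thesis
  proof
    have "homotopic_with (\<lambda>_. True) (nsphere n) (nsphere n)
        (\<lambda>x. sphere_proj n (f x)) (\<lambda>x. sphere_proj n (P x))"
      by (rule homotopic_with_trans[OF homotopic_sphere_proj_segment[OF cfi cQ seg1]
            homotopic_sphere_proj_segment[OF cQ cP seg2]])
    then show "homotopic_with (\<lambda>_. True) (nsphere n) (nsphere n) f (\<lambda>x. sphere_proj n (P x))"
      by (rule homotopic_with_eq) (auto simp: sphere_proj_nsphere fS)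
    have P_neg: "P (\<lambda>i. - x i) = (\<lambda>i. - P x i)" for x
      by (auto simp: P_def Q_neg)
    show "sphere_proj n (P (\<lambda>i. - x i)) = (\<lambda>i. - sphere_proj n (P x) i)" for x
      by (simp add: P_neg sphere_proj_uminus)
    show "sphere_proj n (P x) n = 0" if "x n = 0" for x
      using that by (simp add: sphere_proj_def P_def)
  qed
qed

text \<open>Degree is a homotopy invariant, and for an equator-preserving odd map its parity does not change on
  restriction to the equator.\<close>

theorem odd_Brouwer_degree2:
  fixes a :: "'a::euclidean_space itself"
  assumes "n < DIM('a)"
    and "continuous_map (nsphere n) (nsphere n) f"
    and "\<And>x. x \<in> topspace (nsphere n) \<Longrightarrow> f (\<lambda>i. - x i) = (\<lambda>i. - f x i)"
  shows "odd (Brouwer_degree2 n f)"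
  using assms
proof (induction n arbitrary: f)
  case 0
  then show ?case by (intro odd_Brouwer_degree2_0)
next
  case (Suc n)
  obtain g where g: "homotopic_with (\<lambda>_. True) (nsphere (Suc n)) (nsphere (Suc n)) f g"
    "\<And>x. x \<in> topspace (nsphere (Suc n)) \<Longrightarrow> g (\<lambda>i. - x i) = (\<lambda>i. - g x i)"
    "\<And>x. \<lbrakk>x \<in> topspace (nsphere (Suc n)); x (Suc n) = 0\<rbrakk> \<Longrightarrow> g x (Suc n) = 0"
    using odd_map_homotopic_to_equator_preserving[OF Suc.prems] by blast
  have cg: "continuous_map (nsphere (Suc n)) (nsphere (Suc n)) g"
    using homotopic_with_imp_continuous_maps[OF g(1)] by blast
  have equator: "topspace (nsphere n) = topspace (nsphere (Suc n)) \<inter> {x. x (Suc n) = 0}"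
    using subtopology_nsphere_equator[of n] by (metis topspace_subtopology)
  have gim: "g x \<in> topspace (nsphere n)" if "x \<in> topspace (nsphere n)" for x
    using that cg g(3)[of x] unfolding equator by (auto dest: continuous_map_image_subset_topspace)
  have "continuous_map (nsphere n) (nsphere (Suc n)) g"
    using cg by (metis continuous_map_from_subtopology subtopology_nsphere_equator)
  then have "continuous_map (nsphere n) (nsphere n) g"
    using gim by (subst subtopology_nsphere_equator[symmetric, of n])
      (auto simp: continuous_map_in_subtopology equator)
  then have "odd (Brouwer_degree2 n g)"
    using Suc.prems(1) g(2) by (intro Suc.IH) (auto simp: equator)
  moreover have "even (Brouwer_degree2 (Suc n) g - Brouwer_degree2 n g)"
    using Borsuk_odd_mapping_degree_step[OF cg] g(2) gim by (simp add: o_def)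
  moreover have "Brouwer_degree2 (Suc n) f = Brouwer_degree2 (Suc n) g"
    using g(1) by (rule Brouwer_degree2_homotopic)
  ultimately show ?case by auto
qed

text \<open>An odd map into a lower-dimensional sphere, followed by the inclusion, is an odd self-map that is
  not surjective; its degree would be both zero and odd.\<close>

theorem Borsuk_Ulam_no_odd_map:
  fixes a :: "'a::euclidean_space itself"
  assumes n: "n < DIM('a)" "m < n"
    and f: "continuous_map (nsphere n) (nsphere m) f"
    and odd: "\<And>x. x \<in> topspace (nsphere n) \<Longrightarrow> f (\<lambda>i. - x i) = (\<lambda>i. - f x i)"
  shows False
proof -
  have sub: "nsphere m = subtopology (nsphere n) {x. \<forall>i>m. x i = 0}"
  proof -
    have "{x. (\<Sum>i\<le>m. (x i)\<^sup>2) = 1 \<and> (\<forall>i>m. x i = 0)}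
        = {x. (\<Sum>i\<le>n. (x i)\<^sup>2) = (1::real) \<and> (\<forall>i>n. x i = 0)} \<inter> {x. \<forall>i>m. x i = 0}"
    proof -
      have "(\<Sum>i\<le>n. (x i)\<^sup>2) = (\<Sum>i\<le>m. (x i)\<^sup>2)" if "\<forall>i>m. x i = (0::real)" for x
        using that n by (intro sum.mono_neutral_right) auto
      then show ?thesis using n by auto
    qed
    then show ?thesis by (simp add: nsphere subtopology_subtopology)
  qed
  have cf: "continuous_map (nsphere n) (nsphere n) f"
    using f unfolding sub by (simp add: continuous_map_in_subtopology)
  define e :: "nat \<Rightarrow> real" where "e = (\<lambda>i. if i = n then 1 else 0)"
  have "(\<Sum>i\<le>n. (e i)\<^sup>2) = (\<Sum>i\<le>n. if i = n then 1 else 0)"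
    by (intro sum.cong) (auto simp: e_def)
  then have "e \<in> topspace (nsphere n)"
    by (simp add: topspace_nsphere) (simp add: e_def)
  moreover have "e \<notin> topspace (nsphere m)"
    using n by (auto simp: topspace_nsphere e_def)
  ultimately have "f ` topspace (nsphere n) \<noteq> topspace (nsphere n)"
    using continuous_map_image_subset_topspace[OF f] by auto
  then have "Brouwer_degree2 n f = 0"
    using cf by (intro Brouwer_degree2_nonsurjective)
  moreover have "odd (Brouwer_degree2 n f)"
    using n(1) cf odd by (rule odd_Brouwer_degree2)
  ultimately show False by simp
qed

section \<open>Genus of sets of vectors\<close>

lemma compact_topspace_nsphere: "compact (topspace (nsphere n))"
proof -
  let ?C = "PiE UNIV (\<lambda>i. if i \<le> n then {-1..1} else {0}) :: (nat \<Rightarrow> real) set"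
  have cx: "continuous_on UNIV (\<lambda>x::nat \<Rightarrow> real. x i)" for i
    by (rule continuous_on_product_then_coordinatewise[OF continuous_on_id])
  have "compactin (powertop_real UNIV) ?C"
    by (subst compactin_PiE) (auto simp: compactin_euclidean_iff)
  then have C: "compact ?C"
    by (simp add: euclidean_product_topology)
  have eq: "topspace (nsphere n) = {x. (\<Sum>i\<le>n. (x i)\<^sup>2) = 1} \<inter> (\<Inter>i\<in>{n<..}. {x. x i = 0})"
    by (auto simp: topspace_nsphere)
  have "closed (topspace (nsphere n))"
    unfolding eq by (intro closed_Int closed_INT ballI closed_Collect_eq continuous_intros cx)
  moreover have "topspace (nsphere n) \<subseteq> ?C"
  proof
    fix x assume x: "x \<in> topspace (nsphere n)"
    have "\<bar>x i\<bar> \<le> 1" if "i \<le> n" for i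
    proof -
      have "(x i)\<^sup>2 \<le> (\<Sum>i\<le>n. (x i)\<^sup>2)" using that by (intro member_le_sum) auto
      then show ?thesis using x by (simp add: topspace_nsphere abs_square_le_1)
    qed
    then show "x \<in> ?C" using x by (auto simp: topspace_nsphere abs_le_iff)
  qed
  ultimately have "compact (?C \<inter> topspace (nsphere n))" using C by (intro compact_Int_closed)
  then show ?thesis using \<open>topspace (nsphere n) \<subseteq> ?C\<close> by (simp add: Int_absorb1)
qed

text \<open>Composing a hypothetical odd map of low target dimension with \<open>G\<close> and projecting radially yields an
  odd map between spheres that Borsuk--Ulam excludes.\<close>

lemma genus_odd_sphere_image:
  fixes G :: "(nat \<Rightarrow> real) \<Rightarrow> real ^ 'v::finite"
  assumes n: "n < CARD('v)" and G: "continuous_on (topspace (nsphere n)) G"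
    and odd: "\<And>c. c \<in> topspace (nsphere n) \<Longrightarrow> G (\<lambda>i. - c i) = - G c"
    and nz: "0 \<notin> G ` topspace (nsphere n)"
  shows "n < genus (G ` topspace (nsphere n))"
proof (rule ccontr)
  let ?S = "topspace (nsphere n)"
  assume "\<not> ?thesis"
  then have le: "genus (G ` ?S) \<le> n" by simp
  have "\<exists>m. 0 < m \<and> (\<exists>f. odd_map_into (G ` ?S) m f)"
    using ex_odd_map_into[OF nz] by (intro exI[of _ "CARD('v)"]) simp
  from LeastI_ex[OF this] obtain f where "0 < genus (G ` ?S)" and f: "odd_map_into (G ` ?S) (genus (G ` ?S)) f"
    unfolding genus_def by blast
  then obtain m where m: "genus (G ` ?S) = Suc m" using gr0_conv_Suc by auto
  have cf: "continuous_map (top_of_set (G ` ?S)) (subtopology (Euclidean_space (Suc m)) (- {\<lambda>_. 0})) f"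
    and f_odd: "\<And>x. x \<in> G ` ?S \<Longrightarrow> f (- x) = (\<lambda>i. - f x i)"
    using f unfolding m odd_map_into_def by auto
  have f_nz: "\<exists>j\<le>m. f x j \<noteq> 0" if "x \<in> G ` ?S" for x
  proof -
    have "f x \<in> topspace (subtopology (Euclidean_space (Suc m)) (- {\<lambda>_. 0}))"
      by (rule subsetD[OF continuous_map_image_subset_topspace[OF cf] imageI]) (use that in simp)
    then have "\<forall>i\<ge>Suc m. f x i = 0" "f x \<noteq> (\<lambda>_. 0)"
      by (auto simp: topspace_Euclidean_space)
    then show ?thesis by (metis ext not_less_eq_eq)
  qed
  have "continuous_map (top_of_set (G ` ?S)) (powertop_real UNIV) f"
    using cf by (simp add: continuous_map_in_subtopology Euclidean_space_def)
  then have cf': "continuous_on (G ` ?S) f"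
    by (simp add: euclidean_product_topology)
  define F where "F c = sphere_proj m (f (G c))" for c
  have cfG: "continuous_on ?S (\<lambda>c. f (G c))"
    by (rule continuous_on_compose2[OF cf' G]) simp
  have "continuous_on ?S F"
    unfolding F_def
    by (rule continuous_on_sphere_proj)
      (use f_nz in \<open>auto intro: continuous_on_product_then_coordinatewise[OF cfG]\<close>)
  moreover have "F c \<in> topspace (nsphere m)" if "c \<in> ?S" for c
    unfolding F_def using f_nz that by (intro sphere_proj_in_nsphere) auto
  ultimately have "continuous_map (top_of_set ?S) (top_of_set (topspace (nsphere m))) F"
    by (auto simp: continuous_map_in_subtopology)
  then have "continuous_map (nsphere n) (nsphere m) F"
    by (simp only: nsphere_eq_top_of_set[symmetric])
  moreover have "F (\<lambda>i. - c i) = (\<lambda>i. - F c i)" if "c \<in> ?S" for c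
    using that by (simp add: F_def odd f_odd sphere_proj_uminus)
  ultimately show False
    using Borsuk_Ulam_no_odd_map[where 'a = "real ^ 'v", of n m F] n le m by simp
qed

text \<open>Otherwise the restriction of vectors to the coordinates in \<open>T\<close> is an odd map into a punctured space
  of dimension \<open>card T\<close>.\<close>

lemma genus_class_vanishing:
  fixes S :: "(real ^ 'v::finite) set"
  assumes S: "S \<in> genus_class k" and T: "card T < k"
  shows "\<exists>x\<in>S. \<forall>v\<in>T. x $ v = 0"
proof (rule ccontr)
  assume "\<not> ?thesis"
  then have nz: "\<exists>v\<in>T. x $ v \<noteq> 0" if "x \<in> S" for x using that by blast
  define m where "m = card T"
  obtain b where b: "bij_betw b {0..<m} T"
    using ex_bij_betw_nat_finite[of T] by (auto simp: m_def)
  define f where "f x i = (if i < m then x $ b i else 0)" for x :: "real ^ 'v" and i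
  have "S \<noteq> {}" using S by (simp add: genus_class_def)
  then have "0 < m" using nz by (auto simp: m_def card_gt_0_iff)
  moreover have "odd_map_into S m f"
    unfolding odd_map_into_def
  proof (intro conjI ballI)
    have "f x \<noteq> (\<lambda>_. 0)" if x: "x \<in> S" for x
    proof -
      obtain v where "v \<in> T" "x $ v \<noteq> 0" using nz x by blast
      moreover then obtain i where "i < m" "v = b i" using b by (auto simp: bij_betw_def)
      ultimately have "f x i \<noteq> 0" by (simp add: f_def)
      then show ?thesis by auto
    qed
    moreover have "continuous_map (top_of_set S) (powertop_real UNIV) f"
      unfolding continuous_map_componentwise_UNIV
    proof
      show "continuous_map (top_of_set S) euclideanreal (\<lambda>x. f x i)" for i
        by (cases "i < m") (auto simp: f_def intro!: continuous_intros)
    qed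
    ultimately show "continuous_map (top_of_set S) (subtopology (Euclidean_space m) (- {\<lambda>_. 0})) f"
      by (auto simp: Euclidean_space_def continuous_map_in_subtopology f_def)
  qed (auto simp: f_def)
  ultimately have "genus S \<le> m"
    unfolding genus_def by (intro Least_le) auto
  then show False using S T by (simp add: genus_class_def m_def)
qed

text \<open>Since the \<open>A i\<close> are disjoint and nonempty, their indicator functions are linearly independent, so
  the map from coefficient vectors is odd, continuous and nonvanishing on the sphere.\<close>

lemma genus_class_disjoint_combinations:
  fixes A :: "nat \<Rightarrow> 'v::finite set"
  assumes k: "k \<in> {1..CARD('v)}" and A: "cheeger_tuple k A"
  obtains S where "S \<in> genus_class k"
    "\<And>x. x \<in> S \<Longrightarrow> \<exists>c. \<forall>v. x $ v = (\<Sum>i\<in>{1..k}. c i * indicator (A i) v)"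
proof -
  let ?S = "topspace (nsphere (k - 1))"
  define G where "G c = (\<chi> v. \<Sum>i\<in>{1..k}. c (i - 1) * indicator (A i) v)" for c :: "nat \<Rightarrow> real"
  have G_nz: "G c \<noteq> 0" if c: "c \<in> ?S" for c
  proof -
    have "\<exists>j\<le>k - 1. c j \<noteq> 0"
      using c sum_squares_pos_iff[of c "k - 1"] by (simp add: topspace_nsphere)
    then obtain j where j: "j \<le> k - 1" "c j \<noteq> 0" by blast
    then have ik: "Suc j \<in> {1..k}" using k by auto
    then have "A (Suc j) \<noteq> {}" using A unfolding cheeger_tuple_def by blast
    then obtain v where v: "v \<in> A (Suc j)" by blast
    have "c (i - 1) * indicator (A i) v = (if i = Suc j then c j else 0)" if "i \<in> {1..k}" for i
    proof (cases "i = Suc j")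
      case False
      then have "v \<notin> A i"
        using A that ik v unfolding cheeger_tuple_def disjoint_family_on_def by blast
      then show ?thesis using False by simp
    qed (simp add: v)
    then have "G c $ v = (\<Sum>i\<in>{1..k}. if i = Suc j then c j else 0)"
      unfolding G_def vec_lambda_beta by (intro sum.cong refl)
    also have "\<dots> = c j" using ik by simp
    finally have "G c $ v = c j" .
    then show ?thesis using j by auto
  qed
  have G_odd: "G (\<lambda>i. - c i) = - G c" for c
    by (simp add: G_def vec_eq_iff sum_negf)
  have neg: "(\<lambda>i. - c i) \<in> ?S" if "c \<in> ?S" for c
    using that by (simp add: topspace_nsphere)
  have cont: "continuous_on ?S G"
    unfolding G_def
    by (intro continuous_on_vec_lambda continuous_on_sum continuous_on_mult continuous_on_const
        continuous_on_product_then_coordinatewise[OF continuous_on_id])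
  have "G ` ?S \<in> genus_class k"
    unfolding genus_class_def
  proof (intro CollectI conjI)
    show "G ` ?S \<noteq> {}" using in_topspace_nsphere by blast
    show "compact (G ` ?S)" using cont compact_topspace_nsphere by (rule compact_continuous_image)
    show nz: "0 \<notin> G ` ?S" using G_nz by force
    show "uminus ` G ` ?S = G ` ?S"
    proof -
      have "uminus ` G ` ?S \<subseteq> G ` ?S"
      proof clarify
        fix c assume "c \<in> ?S"
        then show "- G c \<in> G ` ?S" using neg G_odd by (metis imageI)
      qed
      moreover from this have "uminus ` uminus ` G ` ?S \<subseteq> uminus ` G ` ?S" by (rule image_mono)
      ultimately show ?thesis by (simp add: image_image)
    qed
    have "k - 1 < genus (G ` ?S)"
      using k by (intro genus_odd_sphere_image cont G_odd nz) auto
    then show "k \<le> genus (G ` ?S)" by simp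
  qed
  moreover have "\<exists>c. \<forall>v. x $ v = (\<Sum>i\<in>{1..k}. c i * indicator (A i) v)" if x: "x \<in> G ` ?S" for x
  proof -
    obtain c where "x = G c" using x by blast
    then show ?thesis by (intro exI[of _ "\<lambda>i. c (i - 1)"]) (simp add: G_def)
  qed
  ultimately show ?thesis by (rule that)
qed

section \<open>Packing and covering by connected sets in a forest\<close>

text \<open>Connectedness of the induced subgraph, expressed by cuts instead of walks: this form passes directly
  to sets with a leaf removed, and its negation directly yields a splitting without edges across.\<close>

definition edge_connected :: "'v set set \<Rightarrow> 'v set \<Rightarrow> bool" where
  "edge_connected E A \<longleftrightarrow> (\<forall>B. B \<subset> A \<and> B \<noteq> {} \<longrightarrow> (\<exists>u\<in>B. \<exists>v\<in>A - B. {u, v} \<in> E))"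

text \<open>The first vertex of a longest path has, besides its successor, another neighbour; by maximality it
  lies on the path and closes a cycle.\<close>

lemma min_degree_2_imp_cycle:
  assumes W: "finite W" "W \<noteq> {}"
    and deg: "\<And>v. v \<in> W \<Longrightarrow> \<exists>a\<in>W. \<exists>b\<in>W. a \<noteq> b \<and> a \<noteq> v \<and> b \<noteq> v \<and> {v, a} \<in> E \<and> {v, b} \<in> E"
  shows "\<exists>c. cycle_in E c"
proof -
  define is_path where "is_path c \<longleftrightarrow> c \<noteq> [] \<and> distinct c \<and> set c \<subseteq> W \<and>
      (\<forall>i. Suc i < length c \<longrightarrow> {c ! i, c ! Suc i} \<in> E)" for c
  obtain w where "w \<in> W" using W by blast
  then have w: "is_path [w]" by (simp add: is_path_def)
  have bound: "length c \<le> card W" if c: "is_path c" for c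
  proof -
    have "distinct c" "set c \<subseteq> W" using c by (auto simp: is_path_def)
    then show ?thesis using W(1) by (metis card_mono distinct_card)
  qed
  have "\<exists>c. is_path c \<and> (\<forall>d. is_path d \<longrightarrow> length d \<le> length c)"
    using bound
    by (intro ex_has_greatest_nat[where P = is_path and k = "[w]" and f = length and b = "Suc (card W)"] w)
      (simp add: less_Suc_eq_le)
  then obtain c where c: "is_path c" and max: "\<And>d. is_path d \<Longrightarrow> length d \<le> length c"
    by blast
  then have c': "c \<noteq> []" "distinct c" "set c \<subseteq> W"
    and c_edge: "\<And>i. Suc i < length c \<Longrightarrow> {c ! i, c ! Suc i} \<in> E"
    by (auto simp: is_path_def)
  have nbr: "\<exists>j<length c. a = c ! j" if a: "a \<in> W" "{c ! 0, a} \<in> E" for a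
  proof (rule ccontr)
    assume "\<not> ?thesis"
    then have "a \<notin> set c" by (auto simp: in_set_conv_nth)
    moreover have "{(a # c) ! i, (a # c) ! Suc i} \<in> E" if "Suc i < length (a # c)" for i
      using that c_edge a by (cases i) (auto simp: insert_commute)
    ultimately have "is_path (a # c)" using c' a by (simp add: is_path_def)
    then show False using max[of "a # c"] by simp
  qed
  have "c ! 0 \<in> W" using c' by (metis length_greater_0_conv nth_mem subsetD)
  then obtain a b where ab: "a \<in> W" "b \<in> W" "a \<noteq> b" "a \<noteq> c ! 0" "b \<noteq> c ! 0"
    "{c ! 0, a} \<in> E" "{c ! 0, b} \<in> E"
    using deg by metis
  obtain i j where ij: "i < length c" "a = c ! i" "j < length c" "b = c ! j"
    using nbr ab by metis
  then have "i \<noteq> 0" "j \<noteq> 0" "i \<noteq> j" using ab by metis+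
  then have "2 \<le> i \<or> 2 \<le> j" by linarith
  then obtain j where j: "2 \<le> j" "j < length c" "{c ! 0, c ! j} \<in> E"
    using ab(6,7) ij by blast
  let ?d = "take (Suc j) c"
  have "cycle_in E ?d"
    unfolding cycle_in_def
  proof (intro conjI allI impI)
    show "3 \<le> length ?d" using j by simp
    show "distinct ?d" using c' by simp
    fix i assume "i < length ?d"
    then have i: "i \<le> j" using j by simp
    show "{?d ! i, ?d ! (Suc i mod length ?d)} \<in> E"
    proof (cases "i = j")
      case True
      then show ?thesis using j by (simp add: insert_commute min_absorb2)
    next
      case False
      then show ?thesis using i j c_edge[of i] by (simp add: min_absorb2)
    qed
  qed
  then show ?thesis by blast
qed

lemma edge_connected_remove_leaf:
  assumes A: "edge_connected E A" "v \<in> A" and leaf: "\<And>a. \<lbrakk>a \<in> A; {v, a} \<in> E\<rbrakk> \<Longrightarrow> a = u"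
  shows "edge_connected E (A - {v})"
  unfolding edge_connected_def
proof (intro allI impI)
  fix B assume B: "B \<subset> A - {v} \<and> B \<noteq> {}"
  show "\<exists>x\<in>B. \<exists>y\<in>A - {v} - B. {x, y} \<in> E"
  proof (cases "u \<in> B")
    case True
    have sub: "insert v B \<subset> A" using B A(2) by blast
    obtain x y where "x \<in> insert v B" "y \<in> A - insert v B" "{x, y} \<in> E"
      using A(1)[unfolded edge_connected_def, rule_format, OF conjI[OF sub insert_not_empty]] by blast
    then show ?thesis using leaf True by blast
  next
    case False
    have sub: "B \<subset> A" and B_ne: "B \<noteq> {}" using B by blast+
    obtain x y where xy: "x \<in> B" "y \<in> A - B" "{x, y} \<in> E"
      using A(1)[unfolded edge_connected_def, rule_format, OF conjI[OF sub B_ne]] by blast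
    then have "y \<noteq> v" using leaf[of x] B False by (auto simp: insert_commute)
    then show ?thesis using xy by blast
  qed
qed

lemma edge_connected_obtain_neighbour:
  assumes "edge_connected E A" "v \<in> A" "A \<noteq> {v}"
  obtains a where "a \<in> A" "a \<noteq> v" "{v, a} \<in> E"
proof -
  have "{v} \<subset> A" using assms(2,3) by blast
  then obtain a where "a \<in> A - {v}" "{v, a} \<in> E"
    using assms(1)[unfolded edge_connected_def, rule_format, of "{v}"] by blast
  then show ?thesis using that by blast
qed

text \<open>Induction by removing a vertex \<open>v\<close> with at most one neighbour \<open>u\<close>. If \<open>{v}\<close> is in the family, take
  \<open>{v}\<close> into the packing and \<open>v\<close> into the covering, and treat the members that avoid \<open>v\<close>. Otherwise
  every member containing \<open>v\<close> contains \<open>u\<close> as well, so deleting \<open>v\<close> from all members keeps them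
  connected and does not make intersecting members disjoint.\<close>

lemma forest_packing_covering:
  assumes "finite W" and forest: "\<nexists>c. cycle_in E c" and loops: "\<And>v. {v} \<notin> E"
    and "\<And>A. A \<in> F \<Longrightarrow> A \<noteq> {} \<and> A \<subseteq> W \<and> edge_connected E A"
  shows "\<exists>P T. P \<subseteq> F \<and> disjoint P \<and> finite T \<and> card T \<le> card P \<and> (\<forall>A\<in>F. A \<inter> T \<noteq> {})"
  using assms(1,4)
proof (induction "card W" arbitrary: W F rule: less_induct)
  case less
  show ?case
  proof (cases "W = {}")
    case True
    then have "F = {}" using less.prems(2) by auto
    then show ?thesis by (intro exI[of _ "{}"]) simp
  next
    case False
    obtain v where v: "v \<in> W" and leaf0: "\<not> (\<exists>a\<in>W. \<exists>b\<in>W. a \<noteq> b \<and> a \<noteq> v \<and> b \<noteq> v \<and> {v, a} \<in> E \<and> {v, b} \<in> E)"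
      using min_degree_2_imp_cycle[of W E] less.prems(1) False forest by blast
    have ne: "a \<noteq> v" if "{v, a} \<in> E" for a using that loops[of v] by auto
    obtain u where leaf: "\<And>a. \<lbrakk>a \<in> W; {v, a} \<in> E\<rbrakk> \<Longrightarrow> a = u"
      using leaf0 ne by metis
    have less': "card (W - {v}) < card W" "finite (W - {v})"
      using v less.prems(1) by (simp_all add: card_Diff1_less del: card_Diff_insert)
    show ?thesis
    proof (cases "{v} \<in> F")
      case True
      have "\<exists>P T. P \<subseteq> {A \<in> F. v \<notin> A} \<and> disjoint P \<and> finite T \<and> card T \<le> card P \<and>
              (\<forall>A\<in>{A \<in> F. v \<notin> A}. A \<inter> T \<noteq> {})"
        by (rule less.hyps[OF less']) (use less.prems(2) in auto)
      then obtain P T where PT: "P \<subseteq> {A \<in> F. v \<notin> A}" "disjoint P" "finite T" "card T \<le> card P"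
          "\<And>A. \<lbrakk>A \<in> F; v \<notin> A\<rbrakk> \<Longrightarrow> A \<inter> T \<noteq> {}"
        by blast
      have "P \<subseteq> Pow W" using PT(1) less.prems(2) by blast
      then have "finite P" using less.prems(1) finite_subset by (metis finite_Pow_iff)
      moreover have "{v} \<notin> P" using PT(1) by auto
      ultimately have "card (insert v T) \<le> card (insert {v} P)"
        using PT(3,4) by (simp add: card_insert_if)
      moreover have "disjoint (insert {v} P)"
        using PT(1,2) by (auto simp: disjoint_def pairwise_insert disjnt_def)
      moreover have "A \<inter> insert v T \<noteq> {}" if "A \<in> F" for A
        using PT(5)[OF that] by auto
      ultimately show ?thesis
        using True PT(1,3) by (intro exI[of _ "insert {v} P"] exI[of _ "insert v T"]) auto
    next
      case no_singleton: False
      have u: "u \<in> A \<and> u \<noteq> v" if A: "A \<in> F" "v \<in> A" for A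
      proof -
        have "edge_connected E A" "A \<noteq> {v}" "A \<subseteq> W"
          using less.prems(2)[OF A(1)] A(1) no_singleton by auto
        then obtain a where a: "a \<in> A" "a \<noteq> v" "{v, a} \<in> E" "a \<in> W"
          using edge_connected_obtain_neighbour[of E A v] A(2) by (metis subsetD)
        then have "a = u" using leaf by blast
        then show ?thesis using a by blast
      qed
      let ?F = "(\<lambda>A. A - {v}) ` F"
      have "\<exists>P T. P \<subseteq> ?F \<and> disjoint P \<and> finite T \<and> card T \<le> card P \<and> (\<forall>A\<in>?F. A \<inter> T \<noteq> {})"
      proof (rule less.hyps[OF less'])
        fix A' assume "A' \<in> ?F"
        then obtain A where A: "A \<in> F" "A' = A - {v}" by blast
        have "edge_connected E (A - {v})"
        proof (cases "v \<in> A")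
          case True
          then show ?thesis
            using less.prems(2)[OF A(1)] leaf by (intro edge_connected_remove_leaf[of E A v u]) auto
        next
          case False
          then show ?thesis using less.prems(2)[OF A(1)] by simp
        qed
        moreover have "A - {v} \<noteq> {}"
          using less.prems(2)[OF A(1)] no_singleton A(1) by (metis Diff_eq_empty_iff subset_singletonD)
        ultimately show "A' \<noteq> {} \<and> A' \<subseteq> W - {v} \<and> edge_connected E A'"
          using A less.prems(2) by auto
      qed
      then obtain P T where PT: "P \<subseteq> ?F" "disjoint P" "finite T" "card T \<le> card P"
          and hit: "\<forall>A\<in>?F. A \<inter> T \<noteq> {}"
        by (elim exE conjE) (rule that)
      have "\<exists>A. A \<in> F \<and> A - {v} = B" if "B \<in> P" for B
        using subsetD[OF PT(1) that] by (elim imageE) auto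
      then obtain g where g: "\<And>B. B \<in> P \<Longrightarrow> g B \<in> F \<and> g B - {v} = B" by metis
      have "inj_on g P" by (rule inj_onI) (metis g)
      then have "card (g ` P) = card P" by (rule card_image)
      moreover have "disjoint (g ` P)"
      proof (rule disjointI)
        fix X Y assume "X \<in> g ` P" "Y \<in> g ` P" "X \<noteq> Y"
        then obtain B C where BC: "B \<in> P" "C \<in> P" "X = g B" "Y = g C" "B \<noteq> C" by blast
        then have dis: "B \<inter> C = {}" using PT(2) by (auto dest: disjointD)
        have "u \<in> B \<inter> C" if "v \<in> X" "v \<in> Y"
        proof -
          have "X \<in> F" "Y \<in> F" "B = X - {v}" "C = Y - {v}" using BC g by auto
          then show ?thesis using u[of X] u[of Y] that by blast
        qed
        then show "X \<inter> Y = {}" using dis BC g[of B] g[of C] by blast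
      qed
      moreover have "A \<inter> T \<noteq> {}" if "A \<in> F" for A
        using bspec[OF hit imageI[OF that]] by blast
      moreover have "g ` P \<subseteq> F" using g by blast
      ultimately show ?thesis using PT(3,4)
        by (intro exI[of _ "g ` P"] exI[of _ T]) simp
    qed
  qed
qed

section \<open>Inequalities for real powers\<close>

text \<open>Midpoint convexity of a nonpositive power, by the inequality of arithmetic and geometric means.\<close>

lemma powr_midpoint_le:
  fixes m t q :: real
  assumes "q \<le> 0" "0 \<le> t" "t < m"
  shows "2 * m powr q \<le> (m + t) powr q + (m - t) powr q"
proof -
  have "m powr q = sqrt ((m * m) powr q)"
    using assms by (simp add: powr_mult real_sqrt_mult)
  also have "\<dots> \<le> sqrt (((m + t) * (m - t)) powr q)"
  proof -
    have "0 < (m + t) * (m - t)" using assms by simp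
    moreover have "(m + t) * (m - t) \<le> m * m" by (simp add: algebra_simps)
    ultimately show ?thesis using assms by (intro real_sqrt_le_mono powr_mono2') auto
  qed
  also have "\<dots> = sqrt ((m + t) powr q * (m - t) powr q)"
    using assms by (simp add: powr_mult)
  also have "\<dots> \<le> ((m + t) powr q + (m - t) powr q) / 2"
    by (rule arith_geo_mean_sqrt) auto
  finally show ?thesis by simp
qed

text \<open>The derivative of \<open>t powr r\<close> is convex, so its mean over an interval is at least its value at the
  midpoint (the Hermite--Hadamard inequality). The difference of the two sides is a function of the
  half-length of the interval that starts at \<open>0\<close> and increases.\<close>

lemma powr_diff_ge_midpoint_slope:
  fixes A B r :: real
  assumes r: "0 < r" "r \<le> 1" and AB: "0 \<le> B" "B < A"
  shows "(A - B) * (r * ((A + B) / 2) powr (r - 1)) \<le> A powr r - B powr r"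
proof -
  define m where "m = (A + B) / 2"
  define s where "s = (A - B) / 2"
  define g where "g t = (m + t) powr r - (m - t) powr r - 2 * t * (r * m powr (r - 1))" for t
  have s: "0 < s" "s \<le> m" using AB by (auto simp: s_def m_def)
  have "g 0 \<le> g s"
  proof (rule DERIV_nonneg_imp_increasing_open[where f = g])
    show "0 \<le> s" using s by simp
    fix t assume t: "0 < t" "t < s"
    let ?D = "r * (m + t) powr (r - 1) + r * (m - t) powr (r - 1) - 2 * (r * m powr (r - 1))"
    have "(g has_real_derivative ?D) (at t)"
      unfolding g_def using t s by (auto intro!: derivative_eq_intros)
    moreover have "0 \<le> r * ((m + t) powr (r - 1) + (m - t) powr (r - 1) - 2 * m powr (r - 1))"
      using powr_midpoint_le[of "r - 1" t m] r t s by (intro mult_nonneg_nonneg) auto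
    ultimately show "\<exists>y. (g has_real_derivative y) (at t) \<and> 0 \<le> y"
      by (intro exI[of _ ?D]) (simp add: algebra_simps)
  next
    show "continuous_on {0..s} g"
      unfolding g_def using s r by (intro continuous_intros continuous_on_powr') auto
  qed
  moreover have "m + s = A" "m - s = B" by (auto simp: m_def s_def field_simps)
  ultimately have "2 * s * (r * m powr (r - 1)) \<le> A powr r - B powr r"
    by (simp add: g_def)
  moreover have "2 * s = A - B" by (simp add: s_def)
  ultimately show ?thesis by (simp only: m_def)
qed

text \<open>The midpoint estimate for \<open>t powr (1 / p)\<close>, applied between the \<open>p\<close>-th powers. Having the mean of
  these powers here, and not their maximum or sum, is what makes the constant \<open>2 powr (p - 1) / p powr p\<close>
  come out.\<close>

lemma abs_powr_diff_le:
  fixes a b p :: real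
  assumes p: "1 \<le> p" and ab: "0 \<le> a" "0 \<le> b"
  shows "\<bar>a powr p - b powr p\<bar> \<le> p * \<bar>a - b\<bar> * ((a powr p + b powr p) / 2) powr (1 - 1 / p)"
proof -
  have *: "a powr p - b powr p \<le> p * (a - b) * ((a powr p + b powr p) / 2) powr (1 - 1 / p)"
    if ab: "0 \<le> b" "b < a" for a b
  proof -
    let ?m = "(a powr p + b powr p) / 2"
    have lt: "b powr p < a powr p" using ab p by (intro powr_less_mono2) auto
    then have m: "0 < ?m" using powr_ge_zero[of b p] by (simp del: powr_ge_zero)
    have "(a powr p - b powr p) * (1 / p * ?m powr (1 / p - 1)) \<le> a - b"
      using powr_diff_ge_midpoint_slope[of "1 / p" "b powr p" "a powr p"] p ab lt
      by (simp add: powr_powr)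
    then have "(a powr p - b powr p) * (1 / p * ?m powr (1 / p - 1)) * (p * ?m powr (1 - 1 / p))
        \<le> (a - b) * (p * ?m powr (1 - 1 / p))"
      using p by (intro mult_right_mono) auto
    moreover have "?m powr (1 / p - 1) * ?m powr (1 - 1 / p) = 1"
      using m by (simp flip: powr_add)
    then have "(a powr p - b powr p) * (1 / p * ?m powr (1 / p - 1)) * (p * ?m powr (1 - 1 / p))
        = a powr p - b powr p"
      using p by (simp add: field_simps)
    ultimately show ?thesis by (simp add: mult_ac)
  qed
  consider "a = b" | "b < a" | "a < b" by linarith
  then show ?thesis
  proof cases
    case 2
    then have "b powr p < a powr p" using ab p by (intro powr_less_mono2) auto
    then show ?thesis using *[of b a] ab 2 by simp
  next
    case 3
    then have "a powr p < b powr p" using ab p by (intro powr_less_mono2) auto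
    then show ?thesis using *[of a b] ab 3 by (simp add: add.commute)
  qed simp
qed

text \<open>Young's inequality; it takes the place of Hoelder's inequality in the sum over edges.\<close>

lemma young_powr:
  fixes x M p :: real
  assumes "1 \<le> p" "0 \<le> x" "0 \<le> M"
  shows "x * M powr (1 - 1 / p) \<le> x powr p / p + (1 - 1 / p) * M"
proof (cases "x = 0 \<or> M = 0")
  case True
  then show ?thesis using assms by (auto simp: divide_simps)
next
  case False
  then have "(x powr p) powr (1 / p) * M powr (1 - 1 / p) \<le> (1 / p) * x powr p + (1 - 1 / p) * M"
    using assms by (intro Youngs_inequality_0) auto
  then show ?thesis using assms by (simp add: powr_powr)
qed

lemma abs_diff_powr_le:
  fixes a b p :: real
  assumes p: "1 \<le> p"
  shows "\<bar>a - b\<bar> powr p \<le> 2 powr (p - 1) * (\<bar>a\<bar> powr p + \<bar>b\<bar> powr p)"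
proof -
  have one: "1 \<le> 2 powr (p - 1)" using p by (intro ge_one_powr_ge_zero) auto
  show ?thesis
  proof (cases "a = 0 \<or> b = 0")
    case True
    then show ?thesis
      using mult_right_mono[OF one powr_ge_zero[of "\<bar>a\<bar>" p]]
        mult_right_mono[OF one powr_ge_zero[of "\<bar>b\<bar>" p]] p by auto
  next
    case False
    have "((1/2) *\<^sub>R \<bar>a\<bar> + (1/2) *\<^sub>R \<bar>b\<bar>) powr p \<le> (1/2) * \<bar>a\<bar> powr p + (1/2) * \<bar>b\<bar> powr p"
      using convex_onD[OF powr_convex[OF p], of "1/2" "\<bar>a\<bar>" "\<bar>b\<bar>"] False by simp
    then have "((\<bar>a\<bar> + \<bar>b\<bar>) / 2) powr p \<le> (\<bar>a\<bar> powr p + \<bar>b\<bar> powr p) / 2"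
      by (simp add: field_simps)
    moreover have "((\<bar>a\<bar> + \<bar>b\<bar>) / 2) powr p = (\<bar>a\<bar> + \<bar>b\<bar>) powr p / 2 powr p"
      by (simp add: powr_divide)
    ultimately have "(\<bar>a\<bar> + \<bar>b\<bar>) powr p \<le> 2 powr p / 2 * (\<bar>a\<bar> powr p + \<bar>b\<bar> powr p)"
      by (simp add: field_simps)
    then have "(\<bar>a\<bar> + \<bar>b\<bar>) powr p \<le> 2 powr (p - 1) * (\<bar>a\<bar> powr p + \<bar>b\<bar> powr p)"
      by (simp add: powr_diff)
    moreover have "\<bar>a - b\<bar> powr p \<le> (\<bar>a\<bar> + \<bar>b\<bar>) powr p"
      using p by (intro powr_mono2) auto
    ultimately show ?thesis by linarith
  qed
qed

section \<open>Cuts, variation and Rayleigh quotients\<close>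

text \<open>Edges with an orientation, so that each edge is counted twice in sums.\<close>

definition arcs :: "'v set set \<Rightarrow> ('v \<times> 'v) set" where
  "arcs E = {(u, v). {u, v} \<in> E}"

lemma sum_arcs_swap:
  "(\<Sum>(u, v)\<in>arcs E. f v u) = (\<Sum>(u, v)\<in>arcs E. f u v)"
  by (rule sum.reindex_bij_witness[where i = prod.swap and j = prod.swap])
    (auto simp: arcs_def insert_commute)

lemma sum_arcs_degree:
  fixes E :: "'v::finite set set" and w :: "'v set \<Rightarrow> real"
  assumes "\<And>v. \<mu> v = (\<Sum>u | {u, v} \<in> E. w {u, v})"
  shows "(\<Sum>(u, v)\<in>arcs E. w {u, v} * g u) = (\<Sum>u\<in>UNIV. \<mu> u * g u)"
proof -
  have "arcs E = Sigma UNIV (\<lambda>u. {v. {v, u} \<in> E})"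
    by (auto simp: arcs_def insert_commute)
  then have "(\<Sum>(u, v)\<in>arcs E. w {u, v} * g u) = (\<Sum>u\<in>UNIV. \<Sum>v | {v, u} \<in> E. w {u, v} * g u)"
    by (simp add: sum.Sigma)
  also have "\<dots> = (\<Sum>u\<in>UNIV. \<mu> u * g u)"
    by (simp add: assms sum_distrib_right insert_commute)
  finally show ?thesis .
qed

lemma sum_boundary_eq_arcs:
  fixes E :: "'v::finite set set" and w :: "'v set \<Rightarrow> real"
  shows "(\<Sum>e\<in>boundary E A. w e) = (\<Sum>(u, v)\<in>arcs E. w {u, v} * (if u \<in> A \<and> v \<notin> A then 1 else 0))"
proof -
  let ?C = "{(u, v) \<in> arcs E. u \<in> A \<and> v \<notin> A}"
  have "inj_on (\<lambda>(u, v). {u, v}) ?C"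
    by (auto simp: inj_on_def doubleton_eq_iff)
  moreover have "boundary E A = (\<lambda>(u, v). {u, v}) ` ?C"
    by (force simp: boundary_def arcs_def)
  ultimately have "(\<Sum>e\<in>boundary E A. w e) = (\<Sum>(u, v)\<in>?C. w {u, v})"
    by (simp add: sum.reindex case_prod_unfold)
  also have "\<dots> = (\<Sum>(u, v)\<in>arcs E. w {u, v} * (if u \<in> A \<and> v \<notin> A then 1 else 0))"
    by (rule sum.mono_neutral_cong_left) (auto split: if_splits)
  finally show ?thesis .
qed

lemma sum_boundary_eq_variation:
  fixes E :: "'v::finite set set" and w :: "'v set \<Rightarrow> real"
  shows "(\<Sum>(u, v)\<in>arcs E. w {u, v} * \<bar>indicator A u - indicator A v\<bar>) = 2 * (\<Sum>e\<in>boundary E A. w e)"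
proof -
  let ?f = "\<lambda>u v. w {u, v} * (if u \<in> A \<and> v \<notin> A then 1 else 0)"
  have "(\<Sum>(u, v)\<in>arcs E. w {u, v} * \<bar>indicator A u - indicator A v\<bar>)
      = (\<Sum>(u, v)\<in>arcs E. ?f u v + ?f v u)"
    by (intro sum.cong) (auto simp: indicator_def insert_commute)
  also have "\<dots> = (\<Sum>(u, v)\<in>arcs E. ?f u v) + (\<Sum>(u, v)\<in>arcs E. ?f v u)"
    by (simp add: sum.distrib case_prod_unfold)
  also have "(\<Sum>(u, v)\<in>arcs E. ?f v u) = (\<Sum>(u, v)\<in>arcs E. ?f u v)"
    by (rule sum_arcs_swap)
  finally show ?thesis by (simp add: sum_boundary_eq_arcs)
qed

text \<open>Discrete layer-cake argument, by induction on the size of the support: subtracting the smallest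
  positive value from \<open>x\<close> on its support shrinks the support, while the variation and the weighted
  mass drop by that value times the boundary weight and the volume of the support.\<close>

lemma coarea_inequality:
  fixes E :: "'v::finite set set" and w :: "'v set \<Rightarrow> real" and x :: "'v \<Rightarrow> real"
  assumes "\<And>v. 0 \<le> x v"
    and "\<And>A. \<lbrakk>A \<noteq> {}; A \<subseteq> {v. x v \<noteq> 0}\<rbrakk> \<Longrightarrow> h * (\<Sum>v\<in>A. \<mu> v) \<le> (\<Sum>e\<in>boundary E A. w e)"
  shows "h * (\<Sum>v\<in>UNIV. \<mu> v * x v) \<le> (\<Sum>(u, v)\<in>arcs E. w {u, v} * \<bar>x u - x v\<bar>) / 2"
  using assms
proof (induction "card {v. x v \<noteq> 0}" arbitrary: x rule: less_induct)
  case less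
  let ?A = "{v. x v \<noteq> 0}"
  show ?case
  proof (cases "?A = {}")
    case True
    then show ?thesis by simp
  next
    case False
    define m where "m = Min (x ` ?A)"
    have "m \<in> x ` ?A" unfolding m_def using False by (intro Min_in) auto
    then obtain v\<^sub>0 where v\<^sub>0: "x v\<^sub>0 = m" "x v\<^sub>0 \<noteq> 0" by blast
    have m_le: "m \<le> x v" if "x v \<noteq> 0" for v
      unfolding m_def using that by (intro Min_le) auto
    define y where "y v = x v - m * indicator ?A v" for v
    have y0: "0 \<le> y v" for v using m_le[of v] by (auto simp: y_def indicator_def)
    have "{v. y v \<noteq> 0} \<subset> ?A" using v\<^sub>0 by (auto simp: y_def indicator_def)
    then have sub: "{v. y v \<noteq> 0} \<subseteq> ?A" and "card {v. y v \<noteq> 0} < card ?A"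
      by (auto intro: psubset_card_mono)
    then have IH: "h * (\<Sum>v\<in>UNIV. \<mu> v * y v) \<le> (\<Sum>(u, v)\<in>arcs E. w {u, v} * \<bar>y u - y v\<bar>) / 2"
      using y0 less.prems(2) by (intro less.hyps) (auto dest: order_trans)
    have "0 \<le> m" using less.prems(1)[of v\<^sub>0] v\<^sub>0 by simp
    then have "m * (h * (\<Sum>v\<in>?A. \<mu> v)) \<le> m * (\<Sum>e\<in>boundary E ?A. w e)"
      using less.prems(2)[OF False] by (intro mult_left_mono) auto
    also have "\<dots> = m * (\<Sum>(u, v)\<in>arcs E. w {u, v} * \<bar>indicator ?A u - indicator ?A v\<bar>) / 2"
      by (simp add: sum_boundary_eq_variation)
    finally have A: "m * (h * (\<Sum>v\<in>?A. \<mu> v)) \<le> \<dots>" .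
    have "(\<Sum>v\<in>UNIV. \<mu> v * indicator ?A v) = (\<Sum>v\<in>?A. \<mu> v)"
      by (rule sum.mono_neutral_cong_right) (auto simp: indicator_def)
    moreover have "\<mu> v * x v = \<mu> v * y v + m * (\<mu> v * indicator ?A v)" for v
      by (simp add: y_def algebra_simps)
    then have "(\<Sum>v\<in>UNIV. \<mu> v * x v) = (\<Sum>v\<in>UNIV. \<mu> v * y v) + m * (\<Sum>v\<in>UNIV. \<mu> v * indicator ?A v)"
      by (simp only: sum.distrib sum_distrib_left)
    ultimately have vol: "(\<Sum>v\<in>UNIV. \<mu> v * x v) = (\<Sum>v\<in>UNIV. \<mu> v * y v) + m * (\<Sum>v\<in>?A. \<mu> v)"
      by simp
    have "\<bar>x u - x v\<bar> = \<bar>y u - y v\<bar> + m * \<bar>indicator ?A u - indicator ?A v\<bar>" for u v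
      using m_le[of u] m_le[of v] \<open>0 \<le> m\<close>
      by (cases "x u = 0"; cases "x v = 0") (simp_all add: y_def)
    then have "w {u, v} * \<bar>x u - x v\<bar> = w {u, v} * \<bar>y u - y v\<bar>
        + m * (w {u, v} * \<bar>indicator ?A u - indicator ?A v\<bar>)" for u v
      by (simp only: distrib_left mult.left_commute)
    then have "(\<Sum>(u, v)\<in>arcs E. w {u, v} * \<bar>x u - x v\<bar>) = (\<Sum>(u, v)\<in>arcs E. w {u, v} * \<bar>y u - y v\<bar>)
        + m * (\<Sum>(u, v)\<in>arcs E. w {u, v} * \<bar>indicator ?A u - indicator ?A v\<bar>)"
      by (simp only: case_prod_unfold sum.distrib sum_distrib_left)
    then show ?thesis using IH A vol by (simp add: distrib_left mult.left_commute add_divide_distrib)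
  qed
qed

lemma rayleigh_arcs:
  "rayleigh E \<mu> w p x = (\<Sum>(u, v)\<in>arcs E. w {u, v} * \<bar>x $ u - x $ v\<bar> powr p) / 2 /
     (\<Sum>v\<in>UNIV. \<mu> v * \<bar>x $ v\<bar> powr p)"
  unfolding rayleigh_def arcs_def by (rule refl)

context weighted_graph
begin

lemma weight_arcs_nonneg: "(u, v) \<in> arcs E \<Longrightarrow> 0 \<le> w {u, v}"
  using edge_weight_pos by (auto simp: arcs_def less_imp_le)

lemma rayleigh_denominator_pos:
  assumes "x \<noteq> 0"
  shows "0 < (\<Sum>v\<in>UNIV. \<mu> v * \<bar>x $ v\<bar> powr p)"
proof -
  obtain j where "x $ j \<noteq> 0" using assms by (auto simp: vec_eq_iff)
  then show ?thesis
    using vertex_weight_pos by (intro sum_pos2[of _ j]) (auto simp: less_imp_le)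
qed

lemma rayleigh_nonneg: "0 \<le> rayleigh E \<mu> w p x"
  unfolding rayleigh_arcs using weight_arcs_nonneg vertex_weight_pos
  by (intro divide_nonneg_nonneg sum_nonneg) (auto simp: less_imp_le)

text \<open>The function \<open>y = \<bar>x\<bar> powr p\<close> has the same support as \<open>x\<close> and mass \<open>D\<close>, so the co-area inequality
  bounds its variation below by \<open>h * D\<close>. The variation is bounded above edge by edge, where Young's
  inequality with scale \<open>c\<close> splits off the \<open>p\<close>-energy and a part of the edge average of \<open>y\<close>. Since the
  vertex weights are degrees, those averages sum to a multiple of \<open>D\<close>, which is absorbed on the left.\<close>

lemma rayleigh_ge_if_isoperimetric_on_support:
  assumes deg: "\<And>v. \<mu> v = (\<Sum>u | {u, v} \<in> E. w {u, v})" and p: "1 \<le> p" and x: "x \<noteq> 0" and h: "0 \<le> h"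
    and iso: "\<And>A. \<lbrakk>A \<noteq> {}; A \<subseteq> {v. x $ v \<noteq> 0}\<rbrakk> \<Longrightarrow> h \<le> expansion E \<mu> w A"
  shows "2 powr (p - 1) / p powr p * h powr p \<le> rayleigh E \<mu> w p x"
proof (cases "h = 0")
  case True
  then show ?thesis using rayleigh_nonneg by simp
next
  case False
  then have h: "0 < h" using h by simp
  define y where "y v = \<bar>x $ v\<bar> powr p" for v
  define D where "D = (\<Sum>v\<in>UNIV. \<mu> v * y v)"
  define N where "N = (\<Sum>(u, v)\<in>arcs E. w {u, v} * \<bar>x $ u - x $ v\<bar> powr p)"
  \<comment> \<open>The scale that equates the constants: with \<open>p * c = 2 * h\<close> the terms in \<open>D\<close> cancel up to \<open>D / p\<close>.\<close>
  define c where "c = 2 * h / p"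
  have D: "0 < D" unfolding D_def y_def using x by (rule rayleigh_denominator_pos)
  have c: "0 < c" using h p by (simp add: c_def)
  have pc: "p * c = 2 * h" using p by (simp add: c_def)
  have "h * D \<le> (\<Sum>(u, v)\<in>arcs E. w {u, v} * \<bar>y u - y v\<bar>) / 2"
    unfolding D_def
  proof (rule coarea_inequality)
    fix A assume A: "A \<noteq> {}" "A \<subseteq> {v. y v \<noteq> 0}"
    have "0 < (\<Sum>v\<in>A. \<mu> v)" using A vertex_weight_pos by (intro sum_pos) auto
    moreover have "h \<le> expansion E \<mu> w A" using A by (intro iso) (auto simp: y_def)
    ultimately show "h * (\<Sum>v\<in>A. \<mu> v) \<le> (\<Sum>e\<in>boundary E A. w e)"
      by (simp add: expansion_def field_simps)
  qed (simp add: y_def)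
  then have "2 * (h * D) \<le> (\<Sum>(u, v)\<in>arcs E. w {u, v} * \<bar>y u - y v\<bar>)" by simp
  also have "(\<Sum>(u, v)\<in>arcs E. w {u, v} * \<bar>y u - y v\<bar>)
     \<le> (\<Sum>(u, v)\<in>arcs E. w {u, v} * (2 * h * (\<bar>x $ u - x $ v\<bar> powr p / c powr p / p + (1 - 1 / p) * ((y u + y v) / 2))))"
  proof (intro sum_mono, clarify)
    fix u v assume uv: "(u, v) \<in> arcs E"
    let ?\<delta> = "\<bar>x $ u - x $ v\<bar>" and ?M = "(y u + y v) / 2"
    have M: "0 \<le> ?M" by (simp add: y_def)
    have "\<bar>y u - y v\<bar> \<le> p * \<bar>\<bar>x $ u\<bar> - \<bar>x $ v\<bar>\<bar> * ?M powr (1 - 1 / p)"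
      unfolding y_def using p by (intro abs_powr_diff_le) auto
    also have "\<dots> \<le> p * ?\<delta> * ?M powr (1 - 1 / p)"
      using p by (intro mult_right_mono mult_left_mono abs_triangle_ineq3) auto
    also have "\<dots> = p * c * (?\<delta> / c * ?M powr (1 - 1 / p))"
      using c by simp
    also have "\<dots> \<le> p * c * ((?\<delta> / c) powr p / p + (1 - 1 / p) * ?M)"
      using p c M by (intro mult_left_mono young_powr) auto
    also have "\<dots> = 2 * h * (?\<delta> powr p / c powr p / p + (1 - 1 / p) * ?M)"
      using c by (simp only: pc) (simp add: powr_divide)
    finally show "w {u, v} * \<bar>y u - y v\<bar> \<le> w {u, v} * \<dots>"
      using weight_arcs_nonneg[OF uv] by (rule mult_left_mono)
  qed
  also have "\<dots> = 2 * h / (c powr p * p) * N + h * (1 - 1 / p) *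
      ((\<Sum>(u, v)\<in>arcs E. w {u, v} * y u) + (\<Sum>(u, v)\<in>arcs E. w {u, v} * y v))"
    unfolding N_def case_prod_unfold sum_distrib_left sum.distrib[symmetric]
    by (intro sum.cong) (simp_all add: field_simps)
  also have "(\<Sum>(u, v)\<in>arcs E. w {u, v} * y v) = (\<Sum>(u, v)\<in>arcs E. w {u, v} * y u)"
    using sum_arcs_swap[of "\<lambda>u v. w {u, v} * y u" E] by (simp add: insert_commute)
  also have "(\<Sum>(u, v)\<in>arcs E. w {u, v} * y u) = D"
    unfolding D_def by (rule sum_arcs_degree[OF deg])
  also have "2 * h / (c powr p * p) * N + h * (1 - 1 / p) * (D + D)
      = 2 * (h * (N / (c powr p * p) + (1 - 1 / p) * D))"
    by (simp add: algebra_simps)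
  finally have "h * D \<le> h * (N / (c powr p * p) + (1 - 1 / p) * D)" by linarith
  then have "D \<le> N / (c powr p * p) + (1 - 1 / p) * D" using h by simp
  then have "D / p \<le> N / (c powr p * p)" by (simp add: algebra_simps)
  then have "D * c powr p \<le> N" using p c by (simp add: field_simps)
  then have "c powr p / 2 \<le> N / 2 / D" using D by (simp add: field_simps)
  moreover have "c powr p / 2 = 2 powr (p - 1) / p powr p * h powr p"
    using h p by (simp add: c_def powr_divide powr_mult powr_diff)
  ultimately show ?thesis unfolding rayleigh_arcs N_def D_def y_def by simp
qed

text \<open>For an edge inside one \<open>A i\<close> the difference of \<open>x\<close> vanishes; for any other edge the \<open>p\<close>-th power of the
  difference is at most \<open>2 powr (p - 1)\<close> times the sum of the \<open>p\<close>-th powers at its ends, each of which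
  is paid for by the boundary of the set containing that end.\<close>

lemma rayleigh_disjoint_combination_le:
  fixes A :: "nat \<Rightarrow> 'v set" and c :: "nat \<Rightarrow> real"
  assumes p: "1 \<le> p" and I: "finite I" "disjoint_family_on A I"
    and H: "\<And>i. i \<in> I \<Longrightarrow> A i \<noteq> {} \<and> expansion E \<mu> w (A i) \<le> H"
    and x: "x \<noteq> 0" "\<And>v. x $ v = (\<Sum>i\<in>I. c i * indicator (A i) v)"
  shows "rayleigh E \<mu> w p x \<le> 2 powr (p - 1) * H"
proof -
  define D where "D = (\<Sum>v\<in>UNIV. \<mu> v * \<bar>x $ v\<bar> powr p)"
  have D: "0 < D" unfolding D_def using x(1) by (rule rayleigh_denominator_pos)
  have single: "(\<Sum>i\<in>I. g i * indicator (A i) v) = g j" if "j \<in> I" "v \<in> A j" for g :: "nat \<Rightarrow> real" and j v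
  proof -
    have "g i * indicator (A i) v = (if i = j then g j else 0)" if "i \<in> I" for i
      using that \<open>j \<in> I\<close> \<open>v \<in> A j\<close> I(2) by (auto simp: disjoint_family_on_def indicator_def)
    then show ?thesis using that I by simp
  qed
  have xp: "\<bar>x $ v\<bar> powr p = (\<Sum>i\<in>I. \<bar>c i\<bar> powr p * indicator (A i) v)" for v
  proof (cases "\<exists>j\<in>I. v \<in> A j")
    case True
    then show ?thesis using single x(2) by auto
  next
    case False
    then have "indicator (A i) v = (0::real)" if "i \<in> I" for i using that by auto
    then show ?thesis using x(2) by simp
  qed
  have "(\<Sum>(u, v)\<in>arcs E. w {u, v} * \<bar>x $ u - x $ v\<bar> powr p)
      \<le> (\<Sum>(u, v)\<in>arcs E. w {u, v} * (2 powr (p - 1) * (\<Sum>i\<in>I. \<bar>c i\<bar> powr p * \<bar>indicator (A i) u - indicator (A i) v\<bar>)))"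
  proof (intro sum_mono, clarify)
    fix u v assume uv: "(u, v) \<in> arcs E"
    have "\<bar>x $ u - x $ v\<bar> powr p \<le> 2 powr (p - 1) * (\<Sum>i\<in>I. \<bar>c i\<bar> powr p * \<bar>indicator (A i) u - indicator (A i) v\<bar>)"
    proof (cases "\<exists>j\<in>I. u \<in> A j \<and> v \<in> A j")
      case True
      then obtain j where "j \<in> I" "u \<in> A j" "v \<in> A j" by blast
      then have "x $ u = x $ v" by (simp add: x(2) single)
      then show ?thesis by (auto intro!: mult_nonneg_nonneg sum_nonneg)
    next
      case False
      then have "\<bar>c i\<bar> powr p * \<bar>indicator (A i) u - indicator (A i) v\<bar>
          = \<bar>c i\<bar> powr p * indicator (A i) u + \<bar>c i\<bar> powr p * indicator (A i) v" if "i \<in> I" for i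
        using that by (auto simp: indicator_def)
      then have "(\<Sum>i\<in>I. \<bar>c i\<bar> powr p * \<bar>indicator (A i) u - indicator (A i) v\<bar>)
          = \<bar>x $ u\<bar> powr p + \<bar>x $ v\<bar> powr p"
        by (simp add: xp sum.distrib)
      then show ?thesis using abs_diff_powr_le[OF p] by simp
    qed
    then show "w {u, v} * \<bar>x $ u - x $ v\<bar> powr p \<le> w {u, v} * \<dots>"
      using weight_arcs_nonneg[OF uv] by (rule mult_left_mono)
  qed
  also have "\<dots> = 2 powr (p - 1) * (\<Sum>i\<in>I. \<bar>c i\<bar> powr p * (\<Sum>(u, v)\<in>arcs E. w {u, v} * \<bar>indicator (A i) u - indicator (A i) v\<bar>))"
    unfolding case_prod_unfold sum_distrib_left
    by (subst sum.swap) (simp add: mult_ac)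
  also have "\<dots> \<le> 2 powr (p - 1) * (\<Sum>i\<in>I. \<bar>c i\<bar> powr p * (2 * (H * (\<Sum>v\<in>A i. \<mu> v))))"
  proof (intro mult_left_mono sum_mono)
    fix i assume i: "i \<in> I"
    have "0 < (\<Sum>v\<in>A i. \<mu> v)" using H[OF i] vertex_weight_pos by (intro sum_pos) auto
    then have "(\<Sum>e\<in>boundary E (A i). w e) \<le> H * (\<Sum>v\<in>A i. \<mu> v)"
      using H[OF i] by (simp add: expansion_def field_simps)
    then show "(\<Sum>(u, v)\<in>arcs E. w {u, v} * \<bar>indicator (A i) u - indicator (A i) v\<bar>) \<le> 2 * (H * (\<Sum>v\<in>A i. \<mu> v))"
      by (simp add: sum_boundary_eq_variation)
  qed auto
  also have "(\<Sum>i\<in>I. \<bar>c i\<bar> powr p * (2 * (H * (\<Sum>v\<in>A i. \<mu> v)))) = 2 * H * D"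
  proof -
    have "D = (\<Sum>v\<in>UNIV. \<Sum>i\<in>I. \<bar>c i\<bar> powr p * (\<mu> v * indicator (A i) v))"
      unfolding D_def xp by (simp add: sum_distrib_left mult_ac)
    also have "\<dots> = (\<Sum>i\<in>I. \<bar>c i\<bar> powr p * (\<Sum>v\<in>UNIV. \<mu> v * indicator (A i) v))"
      by (subst sum.swap) (simp only: sum_distrib_left)
    also have "\<dots> = (\<Sum>i\<in>I. \<bar>c i\<bar> powr p * (\<Sum>v\<in>A i. \<mu> v))"
    proof -
      have "(\<Sum>v\<in>UNIV. \<mu> v * indicator (A i) v) = (\<Sum>v\<in>A i. \<mu> v)" for i
        by (rule sum.mono_neutral_cong_right) (auto simp: indicator_def)
      then show ?thesis by simp
    qed
    finally have D_eq: "D = (\<Sum>i\<in>I. \<bar>c i\<bar> powr p * (\<Sum>v\<in>A i. \<mu> v))" .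
    show ?thesis unfolding D_eq by (subst sum_distrib_left) (simp only: mult_ac)
  qed
  finally have "(\<Sum>(u, v)\<in>arcs E. w {u, v} * \<bar>x $ u - x $ v\<bar> powr p) \<le> 2 powr (p - 1) * H * 2 * D"
    by (simp add: mult_ac)
  then show ?thesis using D unfolding rayleigh_arcs D_def[symmetric] by (simp add: field_simps)
qed

end

section \<open>Hitting all sets of small expansion\<close>

text \<open>Without edges between \<open>B\<close> and \<open>C\<close> the expansion of the union is a weighted mean of the two.\<close>

lemma (in weighted_graph) expansion_ge_of_split:
  assumes BC: "B \<noteq> {}" "C \<noteq> {}" "B \<inter> C = {}"
    and no_edge: "\<And>u v. \<lbrakk>u \<in> B; v \<in> C\<rbrakk> \<Longrightarrow> {u, v} \<notin> E"
    and h: "h \<le> expansion E \<mu> w B" "h \<le> expansion E \<mu> w C"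
  shows "h \<le> expansion E \<mu> w (B \<union> C)"
proof -
  have vol: "0 < (\<Sum>v\<in>X. \<mu> v)" if "X \<noteq> {}" for X
    using that vertex_weight_pos by (intro sum_pos) auto
  have "(if u \<in> B \<union> C \<and> v \<notin> B \<union> C then 1 else 0)
      = (if u \<in> B \<and> v \<notin> B then 1 else 0) + (if u \<in> C \<and> v \<notin> C then 1 else (0::real))"
    if "(u, v) \<in> arcs E" for u v
    using that no_edge[of u v] no_edge[of v u] BC(3) by (auto simp: arcs_def insert_commute)
  then have "(\<Sum>e\<in>boundary E (B \<union> C). w e) = (\<Sum>(u, v)\<in>arcs E. w {u, v} *
      ((if u \<in> B \<and> v \<notin> B then 1 else 0) + (if u \<in> C \<and> v \<notin> C then 1 else 0)))"
    unfolding sum_boundary_eq_arcs by (intro sum.cong refl) (clarify, simp only:)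
  also have "\<dots> = (\<Sum>e\<in>boundary E B. w e) + (\<Sum>e\<in>boundary E C. w e)"
    unfolding sum_boundary_eq_arcs by (simp only: distrib_left case_prod_unfold sum.distrib)
  finally have cut: "(\<Sum>e\<in>boundary E (B \<union> C). w e) = \<dots>" .
  have "h * (\<Sum>v\<in>B. \<mu> v) \<le> (\<Sum>e\<in>boundary E B. w e)" "h * (\<Sum>v\<in>C. \<mu> v) \<le> (\<Sum>e\<in>boundary E C. w e)"
    using h vol[OF BC(1)] vol[OF BC(2)] by (simp_all add: expansion_def pos_le_divide_eq)
  then have "h * (\<Sum>v\<in>B \<union> C. \<mu> v) \<le> (\<Sum>e\<in>boundary E (B \<union> C). w e)"
    using BC(3) by (simp add: cut sum.union_disjoint distrib_left)
  moreover have "0 < (\<Sum>v\<in>B \<union> C. \<mu> v)" using BC by (intro vol) auto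
  ultimately show ?thesis by (simp add: expansion_def pos_le_divide_eq)
qed

text \<open>Packing and covering for the connected sets of expansion below \<open>h\<close>. A disconnected set avoiding \<open>T\<close>
  is split into parts without edges between them, and these are handled by induction.\<close>

lemma (in weighted_forest) small_hitting_set:
  assumes k: "\<And>A. cheeger_tuple k A \<Longrightarrow> \<exists>i\<in>{1..k}. h \<le> expansion E \<mu> w (A i)"
  obtains T where "card T < k"
    "\<And>A. \<lbrakk>A \<noteq> {}; A \<inter> T = {}\<rbrakk> \<Longrightarrow> h \<le> expansion E \<mu> w A"
proof -
  define F where "F = {A. A \<noteq> {} \<and> edge_connected E A \<and> expansion E \<mu> w A < h}"
  have "\<exists>P T. P \<subseteq> F \<and> disjoint P \<and> finite T \<and> card T \<le> card P \<and> (\<forall>A\<in>F. A \<inter> T \<noteq> {})"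
  proof (rule forest_packing_covering[where W = UNIV and E = E])
    show "\<nexists>c. cycle_in E c" by (rule no_cycle)
    show "{v} \<notin> E" for v using edges by auto
  qed (auto simp: F_def)
  then obtain P T where PT: "P \<subseteq> F" "disjoint P" "card T \<le> card P"
      and hit: "\<forall>A\<in>F. A \<inter> T \<noteq> {}"
    by (elim exE conjE) (rule that)
  have "card P < k"
  proof (rule ccontr)
    assume "\<not> ?thesis"
    then obtain P' where P': "P' \<subseteq> P" "card P' = k" "finite P'"
      by (metis linorder_not_less obtain_subset_with_card_n)
    then obtain f where f: "bij_betw f {1..k} P'"
      using ex_bij_betw_nat_finite_1 by blast
    have fP: "f i \<in> P" if "i \<in> {1..k}" for i
      using that bij_betwE[OF f] P'(1) by auto
    have fF: "f i \<in> F" if "i \<in> {1..k}" for i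
      using PT(1) fP[OF that] by (rule subsetD)
    have "cheeger_tuple k f"
      unfolding cheeger_tuple_def disjoint_family_on_def
    proof (intro conjI ballI impI)
      fix i assume "i \<in> {1..k}"
      from fF[OF this] show "f i \<noteq> {}" unfolding F_def by (elim CollectE conjE)
    next
      fix i j assume ij: "i \<in> {1..k}" "j \<in> {1..k}" "i \<noteq> j"
      then have "f i \<noteq> f j" using inj_onD[OF bij_betw_imp_inj_on[OF f]] by metis
      then show "f i \<inter> f j = {}" by (rule disjointD[OF PT(2) fP[OF ij(1)] fP[OF ij(2)]])
    qed
    then obtain i where "i \<in> {1..k}" "h \<le> expansion E \<mu> w (f i)" using k by blast
    then show False using fF[of i] by (simp add: F_def)
  qed
  moreover have "h \<le> expansion E \<mu> w A" if "A \<noteq> {}" "A \<inter> T = {}" for A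
    using that
  proof (induction "card A" arbitrary: A rule: less_induct)
    case less
    show ?case
    proof (cases "edge_connected E A")
      case True
      then have "A \<notin> F" using hit less.prems(2) by blast
      then show ?thesis using True less.prems(1) by (simp add: F_def)
    next
      case False
      then obtain B where B: "B \<subset> A" "B \<noteq> {}" "\<And>u v. \<lbrakk>u \<in> B; v \<in> A - B\<rbrakk> \<Longrightarrow> {u, v} \<notin> E"
        unfolding edge_connected_def by blast
      have "h \<le> expansion E \<mu> w B" "h \<le> expansion E \<mu> w (A - B)"
        using B less.prems(2) by (intro less.hyps psubset_card_mono; force)+
      then have "h \<le> expansion E \<mu> w (B \<union> (A - B))"
        using B by (intro expansion_ge_of_split) auto
      moreover have "B \<union> (A - B) = A" using B(1) by blast
      ultimately show ?thesis by simp
    qed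
  qed
  ultimately show ?thesis using PT(3) by (intro that[of T]) auto
qed

section \<open>The Cheeger inequality on forests\<close>

theorem corollary3:
  fixes E :: "'v::finite set set" and \<mu> :: "'v \<Rightarrow> real" and w :: "'v set \<Rightarrow> real"
    and p :: real and k :: nat
  assumes "weighted_forest E \<mu> w"
    and "\<And>v. \<mu> v = (\<Sum>u | {u, v} \<in> E. w {u, v})"
    and "1 \<le> p"
    and "k \<in> {1..CARD('v)}"
  shows "2 powr (p - 1) / p powr p * cheeger_const E \<mu> w k powr p \<le> minmax_eigenvalue E \<mu> w p k
    \<and> minmax_eigenvalue E \<mu> w p k \<le> 2 powr (p - 1) * cheeger_const E \<mu> w k"
proof -
  interpret weighted_forest E \<mu> w by (rule assms(1))
  let ?\<phi> = "expansion E \<mu> w" and ?R = "rayleigh E \<mu> w p"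
  define h where "h = cheeger_const E \<mu> w k"
  let ?M = "{Max ((\<lambda>i. ?\<phi> (A i)) ` {1..k}) |A. cheeger_tuple k A}"
  have h_def': "h = Min ?M" by (simp add: h_def cheeger_const_def)
  have k: "1 \<le> k" "k \<le> CARD('v)" using assms(4) by auto
  have finM: "finite ?M" using k(1) by (rule finite_cheeger_values)
  have "?M \<noteq> {}" using ex_cheeger_tuple[OF k(2)] by auto
  then have "h \<in> ?M" unfolding h_def' using finM by (intro Min_in)
  then obtain A where A: "cheeger_tuple k A" and hA: "h = Max ((\<lambda>i. ?\<phi> (A i)) ` {1..k})"
    by blast
  have A_le: "?\<phi> (A i) \<le> h" if "i \<in> {1..k}" for i
    unfolding hA using that by (intro Max_ge) auto
  have h0: "0 \<le> h"
  proof -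
    have "0 \<le> ?\<phi> (A 1)"
      unfolding expansion_def using vertex_weight_pos edge_weight_pos
      by (intro divide_nonneg_nonneg sum_nonneg) (auto simp: boundary_def less_imp_le)
    also have "\<dots> \<le> h" using k(1) by (intro A_le) auto
    finally show ?thesis .
  qed
  have "\<exists>i\<in>{1..k}. h \<le> ?\<phi> (B i)" if B: "cheeger_tuple k B" for B
  proof -
    have "h \<le> Max ((\<lambda>i. ?\<phi> (B i)) ` {1..k})"
      unfolding h_def' using finM B by (intro Min_le) auto
    moreover have "Max ((\<lambda>i. ?\<phi> (B i)) ` {1..k}) \<in> (\<lambda>i. ?\<phi> (B i)) ` {1..k}"
      using k(1) by (intro Max_in) auto
    ultimately show ?thesis by auto
  qed
  then obtain T where T: "card T < k" "\<And>A. \<lbrakk>A \<noteq> {}; A \<inter> T = {}\<rbrakk> \<Longrightarrow> h \<le> ?\<phi> A"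
    using small_hitting_set by blast
  obtain S\<^sub>0 where S\<^sub>0: "S\<^sub>0 \<in> genus_class k"
    "\<And>x. x \<in> S\<^sub>0 \<Longrightarrow> \<exists>c. \<forall>v. x $ v = (\<Sum>i\<in>{1..k}. c i * indicator (A i) v)"
    using genus_class_disjoint_combinations[OF assms(4) A] by blast
  have sup_ge: "?R x \<le> (SUP x\<in>S. ?R x)" if S: "S \<in> genus_class k" and x: "x \<in> S" for S x
    using rayleigh_attains_sup[of S p] S x assms(3) by (auto simp: genus_class_def)
  have "2 powr (p - 1) / p powr p * h powr p \<le> (INF S\<in>genus_class k. SUP x\<in>S. ?R x)"
  proof (rule cINF_greatest)
    show "genus_class k \<noteq> ({} :: (real ^ 'v) set set)" using S\<^sub>0(1) by blast
    fix S :: "(real ^ 'v) set" assume S: "S \<in> genus_class k"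
    obtain x where x: "x \<in> S" "\<And>v. v \<in> T \<Longrightarrow> x $ v = 0"
      using genus_class_vanishing[OF S T(1)] by blast
    have "x \<noteq> 0" using S x(1) by (auto simp: genus_class_def)
    then have "2 powr (p - 1) / p powr p * h powr p \<le> ?R x"
      using x(2) T(2) by (intro rayleigh_ge_if_isoperimetric_on_support assms h0) blast+
    also have "\<dots> \<le> (SUP x\<in>S. ?R x)" using S x(1) by (rule sup_ge)
    finally show "2 powr (p - 1) / p powr p * h powr p \<le> (SUP x\<in>S. ?R x)" .
  qed
  moreover have "(INF S\<in>genus_class k. SUP x\<in>S. ?R x) \<le> 2 powr (p - 1) * h"
  proof (rule cINF_lower2[OF _ S\<^sub>0(1)])
    show "bdd_below ((\<lambda>S. SUP x\<in>S. ?R x) ` genus_class k)"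
    proof (rule bdd_belowI2)
      fix S :: "(real ^ 'v) set" assume S: "S \<in> genus_class k"
      then obtain x where "x \<in> S" by (auto simp: genus_class_def)
      then show "0 \<le> (SUP x\<in>S. ?R x)"
        using sup_ge[OF S] rayleigh_nonneg order_trans by blast
    qed
    show "(SUP x\<in>S\<^sub>0. ?R x) \<le> 2 powr (p - 1) * h"
    proof (rule cSUP_least)
      show "S\<^sub>0 \<noteq> {}" using S\<^sub>0(1) by (auto simp: genus_class_def)
      fix x assume x: "x \<in> S\<^sub>0"
      obtain c where c: "\<And>v. x $ v = (\<Sum>i\<in>{1..k}. c i * indicator (A i) v)"
        using S\<^sub>0(2)[OF x] by blast
      have "x \<noteq> 0" using S\<^sub>0(1) x by (auto simp: genus_class_def)
      then show "?R x \<le> 2 powr (p - 1) * h"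
        using A A_le assms(3) c
        by (intro rayleigh_disjoint_combination_le[where I = "{1..k}" and A = A and c = c])
          (auto simp: cheeger_tuple_def)
    qed
  qed
  ultimately show ?thesis unfolding minmax_eigenvalue_def h_def by blast
qed

end
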